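(* Let $\omega=\exp\{5 i\pi/3\}$ and set $$\zeta_1=\frac{\omega}{2^{4/3}}\left(43-3i\sqrt{771}\right)^{1/3},\qquad \zeta_2=2^{5/3}\omega^2\left(43+3i\sqrt{771}\right)^{1/3},$$ $$\gamma_1=\tfrac14\sqrt{1-\zeta_2-\zeta_2^*}-\tfrac14,\quad \gamma_2=\tfrac{\sqrt2}{2}\sqrt{1-\zeta_1-\zeta_1^*}+\tfrac12,\quad \gamma_3=\tfrac{\sqrt2}{2}\sqrt{1-\zeta_1-\zeta_1^*}-\tfrac12,\quad \gamma_4=\tfrac14\sqrt{1-\zeta_2-\zeta_2^*}+\tfrac14,$$ $$a=\sqrt{\gamma_1^2-1}-\gamma_1,\quad b=\sqrt{\gamma_2^2-1}-\gamma_2,\quad c=\sqrt{\gamma_3^2-1}+\gamma_3,\quad d=\sqrt{\gamma_4^2-1}+\gamma_4,$$ where all square and cube roots are principal, and $^*$ denotes complex conjugation (so numerically $a\approx -0.3396+0.9406i$, $b\approx -0.9635+0.2676i$, $c\approx -0.0365+0.9993i$, $d\approx 0.8396+0.5432i$). Then the matrix $$Y_{9C}=\begin{bmatrix} 1 & 1& 1& 1& 1& 1& 1& 1& 1\\ 1 & a & d & a^{*} & c^{*} & b^{*} & c & b & d^{*}\\ 1 & b & c & b^{*} & a & d^{*} & a^{*} & d & c^{*}\\ 1 & c & b^{*} & c^{*} & d & a & d^{*} & a^{*} & b\\ 1 & b^{*} & c^{*} & b & a^{*} & d & a & d^{*} & c\\ 1 & d & a^{*} & d^{*} & b & c^{*}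 & b^{*} & c & a\\ 1 & a^{*} & d^{*} & a & c & b & c^{*} & b^{*} & d\\ 1 & c^{*} & b & c & d^{*} & a^{*} & d & a & b^{*}\\ 1 & d^{*} & a & d & b^{*} & c & b & c^{*} & a^{*} \end{bmatrix}$$ is a complex Hadamard matrix of order $9$, and it is isolated.
   Context: A complex Hadamard matrix of order $N$ is a matrix $H\in\mathbb{C}^{N\times N}$ all of whose entries have modulus $1$ and which satisfies $HH^{\dagger}=N\mathbb{I}_N$; the set of these is denoted $\mathbb{H}(N)$. Two matrices $H_1,H_2\in\mathbb{H}(N)$ are equivalent if $H_1=D_1P_1H_2P_2D_2$ for some diagonal unitary matrices $D_1,D_2$ and permutation matrices $P_1,P_2$. A matrix $H\in\mathbb{H}(N)$ is isolated if it has a neighborhood in $\mathbb{C}^{N\times N}$ (Euclidean topology) such that every complex Hadamard matrix in this neighborhood is equivalent to $H$. *)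

theory Defs
  imports "HOL-Analysis.Analysis"
begin

definition conj_transpose :: "complex^'n^'m \<Rightarrow> complex^'m^'n" where
  "conj_transpose A = map_matrix cnj (transpose A)"

(* The order N of a square matrix is CARD('n); mat k is k times the identity. *)
definition complex_hadamard :: "complex^'n^'n \<Rightarrow> bool" where
  "complex_hadamard H \<longleftrightarrow>
     (\<forall>i j. cmod (H $ i $ j) = 1) \<and> H ** conj_transpose H = mat (of_nat CARD('n))"

definition unitary_matrix :: "complex^'n^'n \<Rightarrow> bool" where
  "unitary_matrix U \<longleftrightarrow> U ** conj_transpose U = mat 1 \<and> conj_transpose U ** U = mat 1"

definition diagonal_matrix :: "complex^'n^'n \<Rightarrow> bool" where
  "diagonal_matrix D \<longleftrightarrow> (\<forall>i j. i \<noteq> j \<longrightarrow> D $ i $ j = 0)"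

definition permutation_matrix :: "complex^'n^'n \<Rightarrow> bool" where
  "permutation_matrix P \<longleftrightarrow> (\<exists>\<pi>. bij \<pi> \<and> P = (\<chi> i j. if i = \<pi> j then 1 else 0))"

definition hadamard_equiv :: "complex^'n^'n \<Rightarrow> complex^'n^'n \<Rightarrow> bool" where
  "hadamard_equiv H1 H2 \<longleftrightarrow>
     (\<exists>D1 P1 P2 D2.
        diagonal_matrix D1 \<and> unitary_matrix D1 \<and> diagonal_matrix D2 \<and> unitary_matrix D2 \<and>
        permutation_matrix P1 \<and> permutation_matrix P2 \<and>
        H1 = D1 ** P1 ** H2 ** P2 ** D2)"

definition isolated_hadamard :: "complex^'n^'n \<Rightarrow> bool" where
  "isolated_hadamard H \<longleftrightarrow>
     complex_hadamard H \<and>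
     (\<exists>U. open U \<and> H \<in> U \<and> (\<forall>K\<in>U. complex_hadamard K \<longrightarrow> hadamard_equiv K H))"

(* All constants are complex numbers. csqrt is the principal square root (so csqrt x is
   \<i> * sqrt \<bar>x\<bar> for real x < 0), and z powr (1/3) is the principal cube root for z \<noteq> 0. *)

definition omega :: complex where
  "omega = exp (5 * \<i> * of_real pi / 3)"

definition zeta1 :: complex where
  "zeta1 = omega / 2 powr (4/3) * (43 - 3 * \<i> * csqrt 771) powr (1/3)"

definition zeta2 :: complex where
  "zeta2 = 2 powr (5/3) * omega^2 * (43 + 3 * \<i> * csqrt 771) powr (1/3)"

definition gamma1 :: complex where
  "gamma1 = 1/4 * csqrt (1 - zeta2 - cnj zeta2) - 1/4"

definition gamma2 :: complex where
  "gamma2 = csqrt 2 / 2 * csqrt (1 - zeta1 - cnj zeta1) + 1/2"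

definition gamma3 :: complex where
  "gamma3 = csqrt 2 / 2 * csqrt (1 - zeta1 - cnj zeta1) - 1/2"

definition gamma4 :: complex where
  "gamma4 = 1/4 * csqrt (1 - zeta2 - cnj zeta2) + 1/4"

definition Y9C_a :: complex where
  "Y9C_a = csqrt (gamma1^2 - 1) - gamma1"

definition Y9C_b :: complex where
  "Y9C_b = csqrt (gamma2^2 - 1) - gamma2"

definition Y9C_c :: complex where
  "Y9C_c = csqrt (gamma3^2 - 1) + gamma3"

definition Y9C_d :: complex where
  "Y9C_d = csqrt (gamma4^2 - 1) + gamma4"

(* vector places its k-th list entry at index k of type 9, where the index 9 equals 0;
   the primed variables are the complex conjugates. *)
definition Y9C :: "complex^9^9" where
  "Y9C =
    (let a = Y9C_a; b = Y9C_b; c = Y9C_c; d = Y9C_d;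
         a' = cnj a; b' = cnj b; c' = cnj c; d' = cnj d
     in vector
       [vector [1, 1,  1,  1,  1,  1,  1,  1,  1 ],
        vector [1, a,  d,  a', c', b', c,  b,  d'],
        vector [1, b,  c,  b', a,  d', a', d,  c'],
        vector [1, c,  b', c', d,  a,  d', a', b ],
        vector [1, b', c', b,  a', d,  a,  d', c ],
        vector [1, d,  a', d', b,  c', b', c,  a ],
        vector [1, a', d', a,  c,  b,  c', b', d ],
        vector [1, c', b,  c,  d', a', d,  a,  b'],
        vector [1, d', a,  d,  b', c,  b,  c', a']])"

end

theory Submission
  imports Defs
begin

text \<open>
  The four constants are governed by the root \<open>s = 4 Re \<zeta>\<^sub>1\<close> of \<open>s\<^sup>3 - 39 s + 43\<close>, because
  \<open>\<zeta>\<^sub>2 = - 8 \<zeta>\<^sub>1\<^sup>*\<close>. Up to a permutation of rows and columns, \<open>Y\<^sub>9\<^sub>C\<close> is a row and a column of ones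
  around the array \<open>f (i + j)\<close>, \<open>i, j \<in> \<int>/8\<close>, with \<open>f = (a, b, d, c, a\<^sup>*, b\<^sup>*, d\<^sup>*, c\<^sup>*)\<close>. Orthogonality
  of the rows therefore reduces to the autocorrelations of \<open>f\<close>, where the only nontrivial identity is
  an identity between the imaginary parts, equivalent to the cubic equation.

  For isolation, let \<open>K\<close> be a nearby Hadamard matrix with first row and column of ones, and let
  \<open>y\<^sub>i\<^sub>j\<close> be the imaginary parts of the quotients of the entries, with \<open>M = max \<bar>y\<^sub>i\<^sub>j\<bar>\<close>. Orthogonality of the
  rows makes \<open>y\<close> a solution of the linearised equations up to \<open>O(M\<^sup>2)\<close>. The linearised system is
  invariant under \<open>(i, j) \<mapsto> (i + p, j + t)\<close> with \<open>p + t \<in> {0, 4}\<close>, so the maximum may be assumed to occur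
  at \<open>(0, r)\<close> with \<open>r < 4\<close>. For each of these four positions an explicit combination of the equations is
  approximately \<open>y\<^sub>0\<^sub>r\<close> and shows \<open>M \<le> 9/10 M\<close>, hence \<open>M = 0\<close>.
\<close>

section \<open>The constants\<close>

lemma omega_eq: "omega = cis (- (pi / 3))"
proof -
  have "omega = cis (5 * pi / 3)"
    by (simp add: omega_def cis_conv_exp mult_ac)
  also have "\<dots> = cis (- (pi / 3) + 2 * pi)"
    by (simp add: field_simps)
  finally show ?thesis
    using cis_mult[of "- (pi / 3)" "2 * pi"] by simp
qed

lemma omega_Complex: "omega = Complex (1 / 2) (- sqrt 3 / 2)"
  by (simp add: omega_eq complex_eq_iff cos_60 sin_60)

lemma omega_power3: "omega ^ 3 = -1"
  by (simp add: omega_Complex complex_eq_iff power3_eq_cube)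

lemma omega_power2: "omega\<^sup>2 = - cnj omega"
  by (simp add: omega_Complex complex_eq_iff power2_eq_square)

lemma two_powr_4_3: "(2::complex) powr (4 / 3) = of_real (2 powr (4 / 3))"
  using powr_of_real[of 2 "4 / 3"] by simp

lemma two_powr_5_3: "(2::complex) powr (5 / 3) = of_real (8 / 2 powr (4 / 3))"
proof -
  have "(2::real) powr (5 / 3) * 2 powr (4 / 3) = 2 powr 3"
    by (simp flip: powr_add)
  then have "(2::real) powr (5 / 3) = 8 / 2 powr (4 / 3)"
    by (simp add: field_simps)
  then show ?thesis
    using powr_of_real[of 2 "5 / 3"] by simp
qed

lemma two_powr_4_3_cubed: "((2::real) powr (4 / 3)) ^ 3 = 16"
  by (simp add: powr_powr flip: powr_realpow)

abbreviation radicand :: complex where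
  "radicand \<equiv> Complex 43 (- 3 * sqrt 771)"

lemma zeta1_eq: "zeta1 = omega / of_real (2 powr (4 / 3)) * radicand powr (1 / 3)"
proof -
  have "43 - 3 * \<i> * csqrt 771 = radicand"
    by (simp add: complex_eq_iff)
  then show ?thesis
    by (simp add: zeta1_def two_powr_4_3)
qed

text \<open>The radicand lies off the branch cut, so conjugation passes through the principal cube
  root; the rest is \<open>omega\<^sup>2 = - cnj omega\<close> and the matching powers of 2.\<close>

lemma zeta2_eq: "zeta2 = - 8 * cnj zeta1"
proof -
  have "43 + 3 * \<i> * csqrt 771 = cnj radicand"
    by (simp add: complex_eq_iff)
  moreover have "cnj radicand powr (1 / 3) = cnj (radicand powr (1 / 3))"
    by (subst cnj_powr) simp_all
  ultimately show ?thesis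
    by (simp add: zeta2_def zeta1_eq two_powr_5_3 omega_power2)
qed

text \<open>The radicand lies in the open fourth quadrant, so its cube root has argument between
  -pi/6 and 0, and \<open>omega\<close> rotates by -pi/3. This range decides which root of the cubic
  occurs.\<close>

lemma zeta1_polar:
  obtains r \<phi> where "zeta1 = rcis r \<phi>" "0 < r" "- (pi / 2) < \<phi>" "\<phi> < - (pi / 3)"
proof -
  define L where "L = Ln radicand"
  have nz: "radicand \<noteq> 0"
    by (simp add: complex_eq_iff)
  have "\<bar>Im L\<bar> < pi / 2"
    unfolding L_def by (rule Re_Ln_pos_lt_imp) simp
  moreover have "Im L < 0"
    unfolding L_def using Im_Ln_pos_le[OF nz] calculation by (auto simp: L_def not_le)
  ultimately have "- (pi / 2) < Im L / 3 - pi / 3" "Im L / 3 - pi / 3 < - (pi / 3)"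
    by auto
  moreover have "radicand powr (1 / 3) = exp (L / 3)"
    using nz by (simp add: powr_def L_def)
  then have "radicand powr (1 / 3) = rcis (exp (Re L / 3)) (Im L / 3)"
    by (simp add: exp_eq_polar[of "L / 3"] rcis_def)
  then have "zeta1 = rcis (exp (Re L / 3) / 2 powr (4 / 3)) (Im L / 3 - pi / 3)"
    using cis_mult[of "Im L / 3" "- (pi / 3)"] by (simp add: zeta1_eq omega_eq rcis_def mult_ac)
  ultimately show thesis
    by (intro that[of "exp (Re L / 3) / 2 powr (4 / 3)" "Im L / 3 - pi / 3"]) auto
qed

lemma zeta1_cubed: "zeta1 ^ 3 = - radicand / 16"
proof -
  have nz: "radicand \<noteq> 0"
    by (simp add: complex_eq_iff)
  then have "(radicand powr (1 / 3)) ^ 3 = exp (of_nat 3 * (Ln radicand / 3))"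
    unfolding exp_of_nat_mult by (simp add: powr_def)
  also have "\<dots> = radicand"
    using nz by simp
  finally have "(radicand powr (1 / 3)) ^ 3 = radicand" .
  moreover have "complex_of_real (2 powr (4 / 3)) ^ 3 = 16"
    using two_powr_4_3_cubed by (metis of_real_numeral of_real_power)
  ultimately show ?thesis
    by (simp add: zeta1_eq power_mult_distrib power_divide omega_power3)
qed

lemma norm_zeta1: "(cmod zeta1)\<^sup>2 = 13 / 4"
proof -
  have "((cmod zeta1)\<^sup>2) ^ 3 = (cmod (zeta1 ^ 3))\<^sup>2"
    by (simp add: norm_power power_mult[symmetric] mult.commute)
  also have "\<dots> = (13 / 4) ^ 3"
    by (simp add: zeta1_cubed norm_divide power_divide cmod_power2 power_mult_distrib) 
  finally show ?thesis
    by (rule power_eq_imp_eq_base) auto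
qed

section \<open>The cubic equation for \<open>4 * Re zeta1\<close>\<close>

definition cubic_root :: real where
  "cubic_root = 4 * Re zeta1"

text \<open>The triple-angle identity for the real part of a cube, combined with the known cube and
  modulus of \<open>zeta1\<close>.\<close>

lemma cubic_root: "cubic_root ^ 3 - 39 * cubic_root + 43 = 0"
proof -
  have "Re (zeta1 ^ 3) = 4 * Re zeta1 ^ 3 - 3 * Re zeta1 * (cmod zeta1)\<^sup>2"
    unfolding cmod_power2 by (simp add: power3_eq_cube power2_eq_square algebra_simps)
  then show ?thesis
    unfolding zeta1_cubed norm_zeta1 by (simp add: cubic_root_def power_mult_distrib)
qed

text \<open>The argument of \<open>zeta1\<close> has cosine in (0, 1/2), and twice its modulus is
  sqrt 13. The critical points of the cubic are plus and minus sqrt 13, so this selects the middle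
  root.\<close>

lemma cubic_root_bounds: "0 < cubic_root" "cubic_root\<^sup>2 < 13"
proof -
  obtain r \<phi> where r: "zeta1 = rcis r \<phi>" "0 < r" "- (pi / 2) < \<phi>" "\<phi> < - (pi / 3)"
    by (rule zeta1_polar)
  have "cos (- \<phi>) < cos (pi / 3)"
    using r by (intro cos_monotone_0_pi) auto
  moreover have "0 < cos \<phi>"
    using r by (intro cos_gt_zero_pi) auto
  ultimately have c: "0 < cos \<phi>" "cos \<phi> < 1 / 2"
    by (simp_all add: cos_60)
  have s: "cubic_root = 4 * (r * cos \<phi>)"
    by (simp add: cubic_root_def r(1))
  then show pos: "0 < cubic_root"
    unfolding s using c r(2) by simp
  have "cubic_root < 2 * r"
    unfolding s using c r(2) by simp
  then have "cubic_root\<^sup>2 < (2 * r)\<^sup>2"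
    using pos by (intro power_strict_mono) auto
  also have "\<dots> = 13"
    using norm_zeta1 by (simp add: r(1) power_mult_distrib)
  finally show "cubic_root\<^sup>2 < 13" .
qed

lemma cubic_root_enclosure: "114061 / 100000 < cubic_root" "cubic_root < 114062 / 100000"
proof -
  \<comment> \<open>The cubic is strictly decreasing between its critical points, so its sign at
    \<open>x\<close> tells on which side of the root \<open>x\<close> lies.\<close>
  have diff: "cubic_root < x \<longleftrightarrow> x ^ 3 - 39 * x + 43 < 0" if "0 < x" "x\<^sup>2 < 13" for x
  proof -
    have "2 * (cubic_root * x) \<le> cubic_root\<^sup>2 + x\<^sup>2"
      using sum_squares_bound[of cubic_root x] by simp
    then have neg: "cubic_root\<^sup>2 + cubic_root * x + x\<^sup>2 - 39 < 0"
      using that cubic_root_bounds by linarith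
    have "x ^ 3 - 39 * x + 43 = (x - cubic_root) * (cubic_root\<^sup>2 + cubic_root * x + x\<^sup>2 - 39)"
      using cubic_root by (simp add: algebra_simps power2_eq_square power3_eq_cube)
    then show ?thesis
      using neg by (simp add: mult_less_0_iff)
  qed
  show "cubic_root < 114062 / 100000"
    by (subst diff) (simp_all add: power2_eq_square power3_eq_cube)
  \<comment> \<open>\<open>diff\<close> yields only the weak lower bound, so equality is excluded by
    evaluation.\<close>
  have "cubic_root \<noteq> 114061 / 100000"
  proof
    assume "cubic_root = 114061 / 100000"
    with cubic_root have "(114061 / 100000 :: real) ^ 3 - 39 * (114061 / 100000) + 43 = 0"
      by (simp only:)
    then show False
      by (simp add: power3_eq_cube)
  qed
  moreover have "\<not> cubic_root < 114061 / 100000"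
    by (subst diff) (simp_all add: power2_eq_square power3_eq_cube)
  ultimately show "114061 / 100000 < cubic_root"
    by simp
qed

section \<open>Cosines and sines of the four entries\<close>

definition g1 :: real where "g1 = (sqrt (1 + 4 * cubic_root) - 1) / 4"
definition g2 :: real where "g2 = (sqrt (2 - cubic_root) + 1) / 2"
definition g3 :: real where "g3 = (sqrt (2 - cubic_root) - 1) / 2"
definition g4 :: real where "g4 = (sqrt (1 + 4 * cubic_root) + 1) / 4"

lemma gamma_eq:
  "gamma1 = of_real g1" "gamma2 = of_real g2" "gamma3 = of_real g3" "gamma4 = of_real g4"
proof -
  have "1 - zeta2 - cnj zeta2 = of_real (1 + 4 * cubic_root)"
    by (simp add: zeta2_eq cubic_root_def complex_eq_iff)
  then have A: "csqrt (1 - zeta2 - cnj zeta2) = of_real (sqrt (1 + 4 * cubic_root))"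
    using cubic_root_bounds by (simp only: csqrt_of_real)
  have "1 - zeta1 - cnj zeta1 = of_real (1 - cubic_root / 2)"
    by (simp add: cubic_root_def complex_eq_iff)
  then have "csqrt (1 - zeta1 - cnj zeta1) = of_real (sqrt (1 - cubic_root / 2))"
    using cubic_root_enclosure by (simp only: csqrt_of_real)
  moreover have "csqrt 2 = of_real (sqrt 2)"
    by simp
  ultimately have "csqrt 2 / 2 * csqrt (1 - zeta1 - cnj zeta1)
    = of_real (sqrt 2 * sqrt (1 - cubic_root / 2) / 2)"
    by (simp only: of_real_mult of_real_divide of_real_numeral times_divide_eq_left)
  also have "sqrt 2 * sqrt (1 - cubic_root / 2) = sqrt (2 - cubic_root)"
    by (simp add: right_diff_distrib flip: real_sqrt_mult)
  finally have B: "csqrt 2 / 2 * csqrt (1 - zeta1 - cnj zeta1) = of_real (sqrt (2 - cubic_root) / 2)" .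
  show "gamma1 = of_real g1" "gamma4 = of_real g4"
    unfolding gamma1_def gamma4_def A by (simp_all add: g1_def g4_def diff_divide_distrib add_divide_distrib)
  show "gamma2 = of_real g2" "gamma3 = of_real g3"
    unfolding gamma2_def gamma3_def B by (simp_all add: g2_def g3_def diff_divide_distrib add_divide_distrib)
qed

lemma g_enclosure:
  "33962 / 100000 \<le> g1" "g1 \<le> 33963 / 100000"
  "96351 / 100000 \<le> g2" "g2 \<le> 96352 / 100000"
  "- 3649 / 100000 \<le> g3" "g3 \<le> - 3648 / 100000"
  "83962 / 100000 \<le> g4" "g4 \<le> 83963 / 100000"
proof -
  have "235848 / 100000 \<le> sqrt (1 + 4 * cubic_root)" "sqrt (1 + 4 * cubic_root) \<le> 235850 / 100000"
    "92702 / 100000 \<le> sqrt (2 - cubic_root)" "sqrt (2 - cubic_root) \<le> 92704 / 100000"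
    unfolding atomize_conj using cubic_root_enclosure
    by (intro conjI real_le_rsqrt real_le_lsqrt; simp add: power2_eq_square)+
  then show
    "33962 / 100000 \<le> g1" "g1 \<le> 33963 / 100000"
    "96351 / 100000 \<le> g2" "g2 \<le> 96352 / 100000"
    "- 3649 / 100000 \<le> g3" "g3 \<le> - 3648 / 100000"
    "83962 / 100000 \<le> g4" "g4 \<le> 83963 / 100000"
    by (simp_all add: g1_def g2_def g3_def g4_def)
qed

lemma g_less_1: "g1\<^sup>2 < 1" "g2\<^sup>2 < 1" "g3\<^sup>2 < 1" "g4\<^sup>2 < 1"
  using g_enclosure by (simp_all add: abs_square_less_1)

lemma csqrt_square_minus_1:
  assumes "g\<^sup>2 < 1"
  shows "csqrt ((of_real g)\<^sup>2 - 1) = \<i> * of_real (sqrt (1 - g\<^sup>2))"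
proof -
  have "(of_real g)\<^sup>2 - 1 = complex_of_real (g\<^sup>2 - 1)"
    by simp
  then show ?thesis
    using assms by (simp only: csqrt_of_real') simp
qed

text \<open>Each \<open>g\<close> has absolute value below 1, so the outer square roots are purely
  imaginary and the four constants lie on the upper unit semicircle.\<close>

lemma Y9C_eq:
  "Y9C_a = Complex (- g1) (sqrt (1 - g1\<^sup>2))"
  "Y9C_b = Complex (- g2) (sqrt (1 - g2\<^sup>2))"
  "Y9C_c = Complex g3 (sqrt (1 - g3\<^sup>2))"
  "Y9C_d = Complex g4 (sqrt (1 - g4\<^sup>2))"
  by (simp_all only: Y9C_a_def Y9C_b_def Y9C_c_def Y9C_d_def gamma_eq csqrt_square_minus_1 g_less_1)
    (simp_all add: complex_eq_iff)

text \<open>Polynomial identities in the two square roots \<open>P\<close> and \<open>Q\<close>, in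
  which \<open>cubic_root\<close> cancels; the cubic equation itself is spent on
  \<open>sine_relation\<close>.\<close>

lemma g_relations:
  "g4 - g1 = 1 / 2" "g2 - g3 = 1" "g1 * g4 + g2 * g3 = 1 / 4" "g1\<^sup>2 + g2\<^sup>2 + g3\<^sup>2 + g4\<^sup>2 = 7 / 4"
proof -
  define P where "P = sqrt (1 + 4 * cubic_root)"
  define Q where "Q = sqrt (2 - cubic_root)"
  have PQ: "P\<^sup>2 = 1 + 4 * cubic_root" "Q\<^sup>2 = 2 - cubic_root"
    using cubic_root_enclosure by (simp_all add: P_def Q_def)
  have g: "g1 = (P - 1) / 4" "g2 = (Q + 1) / 2" "g3 = (Q - 1) / 2" "g4 = (P + 1) / 4"
    by (simp_all add: g1_def g2_def g3_def g4_def P_def Q_def)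
  show "g4 - g1 = 1 / 2" "g2 - g3 = 1"
    by (simp_all add: g field_simps)
  show "g1 * g4 + g2 * g3 = 1 / 4" "g1\<^sup>2 + g2\<^sup>2 + g3\<^sup>2 + g4\<^sup>2 = 7 / 4"
    using PQ by (simp_all add: g power2_eq_square field_simps)
qed

text \<open>Both sides are nonnegative, so squares are compared. The auxiliary root \<open>R\<close>
  simplifies \<open>sa * sd\<close>, and the difference of the squares becomes a multiple of
  \<open>R * (1 + s) - (7 - 2 * s)\<close>.\<close>

lemma sine_relation:
  "sqrt (1 - g2\<^sup>2) * (sqrt (1 - g1\<^sup>2) + sqrt (1 - g4\<^sup>2)) =
   sqrt (1 - g3\<^sup>2) * (sqrt (1 - g1\<^sup>2) - sqrt (1 - g4\<^sup>2))"
proof -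
  define s where "s = cubic_root"
  define P where "P = sqrt (1 + 4 * s)"
  define Q where "Q = sqrt (2 - s)"
  define R where "R = sqrt (6 - s)"
  define sa where "sa = sqrt (1 - g1\<^sup>2)"
  define sb where "sb = sqrt (1 - g2\<^sup>2)"
  define sc where "sc = sqrt (1 - g3\<^sup>2)"
  define sd where "sd = sqrt (1 - g4\<^sup>2)"
  have s: "1 < s" "s < 6 / 5" "s ^ 3 = 39 * s - 43"
    using cubic_root_enclosure cubic_root by (simp_all add: s_def)
  have sq: "P\<^sup>2 = 1 + 4 * s" "Q\<^sup>2 = 2 - s" "R\<^sup>2 = 6 - s"
    using s by (simp_all add: P_def Q_def R_def)
  have g: "g1 = (P - 1) / 4" "g2 = (Q + 1) / 2" "g3 = (Q - 1) / 2" "g4 = (P + 1) / 4"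
    by (simp_all add: g1_def g2_def g3_def g4_def P_def Q_def s_def)
  have "sa\<^sup>2 = 1 - g1\<^sup>2" "sb\<^sup>2 = 1 - g2\<^sup>2" "sc\<^sup>2 = 1 - g3\<^sup>2" "sd\<^sup>2 = 1 - g4\<^sup>2"
    using g_less_1 by (simp_all add: sa_def sb_def sc_def sd_def)
  moreover have "1 - g1\<^sup>2 = (14 - 4 * s + 2 * P) / 16" "1 - g4\<^sup>2 = (14 - 4 * s - 2 * P) / 16"
    "1 - g2\<^sup>2 = (1 + s - 2 * Q) / 4" "1 - g3\<^sup>2 = (1 + s + 2 * Q) / 4"
    using sq by (simp_all add: g power2_eq_square field_simps)
  ultimately have sines: "sa\<^sup>2 = (14 - 4 * s + 2 * P) / 16" "sd\<^sup>2 = (14 - 4 * s - 2 * P) / 16"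
    "sb\<^sup>2 = (1 + s - 2 * Q) / 4" "sc\<^sup>2 = (1 + s + 2 * Q) / 4"
    by simp_all
  have nonneg: "0 \<le> sa" "0 \<le> sb" "0 \<le> sc" "0 \<le> sd" "0 \<le> P" "0 \<le> Q" "0 \<le> R"
    using g_less_1 s by (simp_all add: sa_def sb_def sc_def sd_def P_def Q_def R_def)
  \<comment> \<open>Expanded, this is exactly the cubic equation. Both bases are nonnegative in the
    given range of \<open>s\<close>, so the squares can be removed.\<close>
  have "(R * (1 + s))\<^sup>2 = (7 - 2 * s)\<^sup>2"
    using s(3) by (simp add: power_mult_distrib sq) (simp add: power2_eq_square power3_eq_cube algebra_simps)
  then have R: "R * (1 + s) = 7 - 2 * s"
    using nonneg s by (intro power2_eq_imp_eq[of "R * (1 + s)"]) auto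
  have "(sa * sd)\<^sup>2 = (Q * R / 4)\<^sup>2"
    using sq by (simp add: power_mult_distrib power_divide sines) (simp add: power2_eq_square algebra_simps)
  then have ad: "sa * sd = Q * R / 4"
    using nonneg by (intro power2_eq_imp_eq[of "sa * sd"]) auto
  have "sd\<^sup>2 \<le> sa\<^sup>2"
    using nonneg by (simp add: sines)
  then have "sd \<le> sa"
    using nonneg by (simp add: power_mono_iff)
  have "(sb * (sa + sd))\<^sup>2 - (sc * (sa - sd))\<^sup>2
    = (sb\<^sup>2 - sc\<^sup>2) * (sa\<^sup>2 + sd\<^sup>2) + 2 * (sa * sd) * (sb\<^sup>2 + sc\<^sup>2)"
    by (simp add: power2_eq_square algebra_simps)
  also have "\<dots> = Q * (R * (1 + s) - (7 - 2 * s)) / 4"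
    unfolding ad sines by (simp add: field_simps)
  also have "\<dots> = 0"
    by (simp add: R)
  finally have "(sb * (sa + sd))\<^sup>2 = (sc * (sa - sd))\<^sup>2"
    by simp
  then have "sb * (sa + sd) = sc * (sa - sd)"
    using nonneg \<open>sd \<le> sa\<close> by (intro power2_eq_imp_eq[of "sb * (sa + sd)"]) auto
  then show ?thesis
    by (simp add: sa_def sb_def sc_def sd_def)
qed

section \<open>Certificates for the linearised system\<close>

text \<open>The values of \<open>1000 f\<close>, rounded to integers.\<close>

definition core_re :: "int list" where
  "core_re = [-340, -964, 840, -36, -340, -964, 840, -36]"

definition core_im :: "int list" where
  "core_im = [941, 268, 543, 999, -941, -268, -543, -999]"

text \<open>Index 8 is the row of ones; the column of ones is omitted.\<close>

definition approx_re :: "nat \<Rightarrow> nat \<Rightarrow> int" where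
  "approx_re i j = (if i < 8 then core_re ! ((i + j) mod 8) else 1000)"

definition approx_im :: "nat \<Rightarrow> nat \<Rightarrow> int" where
  "approx_im i j = (if i < 8 then core_im ! ((i + j) mod 8) else 0)"

text \<open>
  For each \<open>r < 4\<close>, the part above the diagonal of a skew-Hermitian matrix of order 9, each complex
  entry as a pair. It is 100 times the row for \<open>y\<^sub>0\<^sub>r\<close> of the pseudoinverse of the linearised system,
  rounded.
\<close>

definition weights0 :: "(int \<times> int) list list" where
  "weights0 = [
    [(4, 1), (-18, -9), (-5, -6), (-12, 11), (2, 8), (-28, -6), (-18, 12), (-25, -17)],
    [(17, -8), (2, -3), (-13, -5), (3, 1), (10, -8), (10, -3), (-24, -8)],
    [(-5, 1), (8, 1), (-1, 7), (3, -5), (3, -4), (-9, -8)],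
    [(4, -1), (-16, 3), (5, 4), (4, 5), (-5, -6)],
    [(-1, 9), (-7, 3), (-1, 4), (-5, 4)],
    [(14, -1), (-9, 8), (-19, -2)],
    [(-8, -3), (5, 4)],
    [(-18, 16)]]"

definition weights1 :: "(int \<times> int) list list" where
  "weights1 = [
    [(-10, -2), (-18, -10), (-9, 17), (0, 4), (-17, -2), (2, 3), (-8, -19), (-40, -5)],
    [(7, -2), (-10, 2), (1, 5), (0, -8), (2, 4), (-7, -4), (-2, -5)],
    [(6, -4), (-10, 5), (3, 9), (3, 0), (5, -9), (-18, -15)],
    [(5, 10), (-10, 3), (1, 8), (6, -12), (-15, 10)],
    [(-2, -2), (-2, 5), (4, 3), (-4, 0)],
    [(-4, 3), (-21, -3), (-1, 7)],
    [(7, 6), (-5, 7)],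
    [(-14, -11)]]"

definition weights2 :: "(int \<times> int) list list" where
  "weights2 = [
    [(-6, 11), (-31, -1), (-15, 14), (-5, -14), (-16, -8), (-6, 5), (-17, 7), (-4, -12)],
    [(13, -10), (-9, 8), (-3, 7), (0, -3), (4, 6), (2, -1), (-13, -10)],
    [(8, 11), (-4, -1), (0, 4), (0, -5), (3, 5), (-25, 8)],
    [(6, -3), (-11, 5), (-1, 2), (11, -2), (-20, 4)],
    [(-7, -5), (-5, -5), (6, -5), (0, 0)],
    [(5, 6), (-29, -7), (-10, 12)],
    [(1, -10), (-4, -13)],
    [(-23, -1)]]"

definition weights3 :: "(int \<times> int) list list" where
  "weights3 = [
    [(-16, -3), (-39, 11), (-8, -8), (-16, -3), (7, -1), (-9, 5), (1, -10), (-20, -21)],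
    [(24, 12), (-1, 0), (-16, 2), (-2, 0), (6, 9), (-12, 6), (-13, 14)],
    [(6, -2), (12, 1), (-8, -6), (0, 9), (3, 3), (-28, 7)],
    [(0, -1), (-1, -5), (-2, -7), (7, 5), (-7, 0)],
    [(-4, -2), (-21, -3), (8, -3), (-3, 1)],
    [(15, -4), (-6, -1), (-16, -7)],
    [(3, 11), (-15, 1)],
    [(3, -12)]]"

text \<open>Below the diagonal the real part changes sign while \<open>weight_im\<close> does not,
  which makes the full matrix skew-Hermitian. Each stored row begins just right of the diagonal,
  hence the index \<open>k - i - 1\<close>.\<close>

definition weight_re :: "(int \<times> int) list list \<Rightarrow> nat \<Rightarrow> nat \<Rightarrow> int" where
  "weight_re U i k = (if i < k then fst (U ! i ! (k - i - 1))
     else if k < i then - fst (U ! k ! (i - k - 1)) else 0)"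

definition weight_im :: "(int \<times> int) list list \<Rightarrow> nat \<Rightarrow> nat \<Rightarrow> int" where
  "weight_im U i k = (if i < k then snd (U ! i ! (k - i - 1))
     else if k < i then snd (U ! k ! (i - k - 1)) else 0)"

text \<open>The real part of the sum over \<open>k\<close> of weight (i, k) times entry (i, j) times
  the conjugate of entry (k, j), in integers so that it can be evaluated exactly.\<close>

definition coefficient :: "(int \<times> int) list list \<Rightarrow> nat \<Rightarrow> nat \<Rightarrow> int" where
  "coefficient U i j = (\<Sum>k\<leftarrow>[0..<9].
     weight_re U i k * (approx_re i j * approx_re k j + approx_im i j * approx_im k j) -
     weight_im U i k * (approx_im i j * approx_re k j - approx_re i j * approx_im k j))"

text \<open>The factor \<open>10\<^sup>8 = 100 * 1000\<^sup>2\<close> compensates the scaling of the weights and of the two matrix entries.\<close>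

definition certificate :: "(int \<times> int) list list \<Rightarrow> nat \<Rightarrow> bool" where
  "certificate U r \<longleftrightarrow>
     (\<Sum>i\<leftarrow>[0..<8]. \<Sum>j\<leftarrow>[0..<8].
        \<bar>coefficient U i j - (if i = 0 \<and> j = r then 10 ^ 8 else 0)\<bar>) \<le> 45 * 10 ^ 6 \<and>
     (\<Sum>i\<leftarrow>[0..<9]. \<Sum>k\<leftarrow>[0..<9]. \<bar>weight_re U i k\<bar> + \<bar>weight_im U i k\<bar>) \<le> 1140"

lemma certificate_weights0: "certificate weights0 0"
  by code_simp

lemma certificate_weights1: "certificate weights1 1"
  by code_simp

lemma certificate_weights2: "certificate weights2 2"
  by code_simp

lemma certificate_weights3: "certificate weights3 3"
  by code_simp

lemma certificate_exists:
  assumes "r < 4"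
  obtains U where "certificate U r"
proof -
  have "r \<in> {0, 1, 2, 3}"
    using assms by auto
  then show thesis
    using that certificate_weights0 certificate_weights1 certificate_weights2 certificate_weights3
    by blast
qed

section \<open>Pairing the linearised equations with skew-Hermitian weights\<close>

lemma sum_list_map_upt: "(\<Sum>i\<leftarrow>[0..<n]. f i) = (\<Sum>i<n. f i)"
  by (simp add: interv_sum_list_conv_sum_set_nat atLeast0LessThan)

text \<open>Exchanging \<open>i\<close> and \<open>k\<close> turns the part with
  \<open>y k j\<close> into minus the conjugate of the part with \<open>y i j\<close>. Both parts
  contribute equally, whence the factor 2.\<close>

lemma skew_pairing:
  fixes V F :: "nat \<Rightarrow> nat \<Rightarrow> complex" and y :: "nat \<Rightarrow> nat \<Rightarrow> real"
  assumes skew: "\<And>i k. V k i = - cnj (V i k)"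
  shows "(\<Sum>i<m. \<Sum>k<m. Re (V i k * (\<Sum>j<n. F i j * cnj (F k j) * of_real (y i j - y k j))))
       = 2 * (\<Sum>i<m. \<Sum>j<n. (\<Sum>k<m. Re (V i k * (F i j * cnj (F k j)))) * y i j)"
proof -
  define T where "T = (\<Sum>i<m. \<Sum>k<m. Re (V i k * (\<Sum>j<n. F i j * cnj (F k j) * of_real (y i j))))"
  define T' where "T' = (\<Sum>i<m. \<Sum>k<m. Re (V i k * (\<Sum>j<n. F i j * cnj (F k j) * of_real (y k j))))"
  have split: "(\<Sum>i<m. \<Sum>k<m. Re (V i k * (\<Sum>j<n. F i j * cnj (F k j) * of_real (y i j - y k j))))
      = T - T'"
    unfolding T_def T'_def sum_subtractf[symmetric] minus_complex.simps(1)[symmetric]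
      right_diff_distrib[symmetric] of_real_diff ..
  have "T' = (\<Sum>i<m. \<Sum>k<m. Re (V k i * (\<Sum>j<n. F k j * cnj (F i j) * of_real (y i j))))"
    unfolding T'_def by (rule sum.swap)
  also have "\<dots> = (\<Sum>i<m. \<Sum>k<m. - Re (V i k * (\<Sum>j<n. F i j * cnj (F k j) * of_real (y i j))))"
  proof (intro sum.cong refl)
    fix i k
    have "V k i * (\<Sum>j<n. F k j * cnj (F i j) * of_real (y i j))
        = - cnj (V i k * (\<Sum>j<n. F i j * cnj (F k j) * of_real (y i j)))"
      by (simp add: skew[of k i] cnj_sum mult_ac)
    then show "Re (V k i * (\<Sum>j<n. F k j * cnj (F i j) * of_real (y i j)))
        = - Re (V i k * (\<Sum>j<n. F i j * cnj (F k j) * of_real (y i j)))"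
      by (simp only: uminus_complex.simps cnj.simps)
  qed
  also have "\<dots> = - T"
    by (simp only: T_def sum_negf)
  finally have "T' = - T" .
  moreover have "T = (\<Sum>i<m. \<Sum>j<n. (\<Sum>k<m. Re (V i k * (F i j * cnj (F k j)))) * y i j)"
    unfolding T_def
  proof (rule sum.cong[OF refl])
    fix i
    have "(\<Sum>k<m. Re (V i k * (\<Sum>j<n. F i j * cnj (F k j) * of_real (y i j))))
        = (\<Sum>k<m. \<Sum>j<n. Re (V i k * (F i j * cnj (F k j))) * y i j)"
    proof (rule sum.cong[OF refl])
      fix k
      show "Re (V i k * (\<Sum>j<n. F i j * cnj (F k j) * of_real (y i j)))
        = (\<Sum>j<n. Re (V i k * (F i j * cnj (F k j))) * y i j)"
        unfolding sum_distrib_left Re_sum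
        by (intro sum.cong refl) (simp add: algebra_simps)
    qed
    also have "\<dots> = (\<Sum>j<n. \<Sum>k<m. Re (V i k * (F i j * cnj (F k j))) * y i j)"
      by (rule sum.swap)
    finally show "(\<Sum>k<m. Re (V i k * (\<Sum>j<n. F i j * cnj (F k j) * of_real (y i j))))
        = (\<Sum>j<n. (\<Sum>k<m. Re (V i k * (F i j * cnj (F k j)))) * y i j)"
      by (simp add: sum_distrib_right)
  qed
  ultimately show ?thesis
    using split by simp
qed

definition approx :: "nat \<Rightarrow> nat \<Rightarrow> complex" where
  "approx i j = Complex (of_int (approx_re i j)) (of_int (approx_im i j))"

text \<open>The weighted sum of the equations equals \<open>2 * S\<close> and is at most
  \<open>1140 * e\<close>, which gives \<open>570 * e\<close>. By the first half of
  \<open>certificate\<close>, \<open>S\<close> differs from \<open>10 ^ 8 * y 0 r\<close> by at most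
  \<open>45 * 10 ^ 6 * M\<close>.\<close>

lemma certificate_bound:
  fixes y :: "nat \<Rightarrow> nat \<Rightarrow> real"
  assumes cert: "certificate U r" and r: "r < 8"
    and border: "\<And>j. y 8 j = 0"
    and y: "\<And>i j. i < 8 \<Longrightarrow> j < 8 \<Longrightarrow> \<bar>y i j\<bar> \<le> M"
    and e: "\<And>i k. i < 9 \<Longrightarrow> k < 9 \<Longrightarrow> i \<noteq> k \<Longrightarrow>
      cmod (\<Sum>j<8. approx i j * cnj (approx k j) * of_real (y i j - y k j)) \<le> e"
  shows "10 ^ 8 * \<bar>y 0 r\<bar> \<le> 45 * 10 ^ 6 * M + 570 * e"
proof -
  define V where "V i k = Complex (of_int (weight_re U i k)) (of_int (weight_im U i k))" for i k
  define E where "E i k = (\<Sum>j<8. approx i j * cnj (approx k j) * of_real (y i j - y k j))" for i k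
  define \<delta> where "\<delta> i j = (if i = (0::nat) \<and> j = r then 10 ^ 8 else 0 :: int)" for i j
  have M: "0 \<le> M"
    using y[of 0 0] by simp
  have e0: "0 \<le> e"
    using order_trans[OF norm_ge_zero e[of 0 1]] by simp
  have skew: "V k i = - cnj (V i k)" for i k
    by (auto simp: V_def weight_re_def weight_im_def complex_eq_iff)
  have coef: "(\<Sum>k<9. Re (V i k * (approx i j * cnj (approx k j)))) = of_int (coefficient U i j)" for i j
    by (simp add: coefficient_def sum_list_map_upt V_def approx_def algebra_simps)
  have c1: "(\<Sum>i<8. \<Sum>j<8. \<bar>real_of_int (coefficient U i j) - of_int (\<delta> i j)\<bar>) \<le> 45 * 10 ^ 6"
  proof -
    have "(\<Sum>i<8. \<Sum>j<8. \<bar>coefficient U i j - \<delta> i j\<bar>) \<le> 45 * 10 ^ 6"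
      using cert by (simp add: certificate_def sum_list_map_upt \<delta>_def)
    then have "real_of_int (\<Sum>i<8. \<Sum>j<8. \<bar>coefficient U i j - \<delta> i j\<bar>) \<le> real_of_int (45 * 10 ^ 6)"
      by (rule of_int_le_iff[THEN iffD2])
    then show ?thesis
      by simp
  qed
  have c2: "(\<Sum>i<9. \<Sum>k<9. cmod (V i k)) \<le> 1140"
  proof -
    have "(\<Sum>i<9. \<Sum>k<9. \<bar>weight_re U i k\<bar> + \<bar>weight_im U i k\<bar>) \<le> 1140"
      using cert by (simp add: certificate_def sum_list_map_upt)
    then have "real_of_int (\<Sum>i<9. \<Sum>k<9. \<bar>weight_re U i k\<bar> + \<bar>weight_im U i k\<bar>) \<le> real_of_int 1140"
      by (rule of_int_le_iff[THEN iffD2])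
    moreover have "(\<Sum>i<9. \<Sum>k<9. cmod (V i k))
        \<le> (\<Sum>i<9. \<Sum>k<9. real_of_int (\<bar>weight_re U i k\<bar> + \<bar>weight_im U i k\<bar>))"
    proof (intro sum_mono)
      fix i k
      show "cmod (V i k) \<le> real_of_int (\<bar>weight_re U i k\<bar> + \<bar>weight_im U i k\<bar>)"
        using cmod_le[of "V i k"] by (simp add: V_def)
    qed
    ultimately show ?thesis
      by simp
  qed
  define S where "S = (\<Sum>i<8. \<Sum>j<8. of_int (coefficient U i j) * y i j)"
  have "(\<Sum>i<9. \<Sum>k<9. Re (V i k * E i k)) = 2 * (\<Sum>i<9. \<Sum>j<8. of_int (coefficient U i j) * y i j)"
    unfolding E_def skew_pairing[OF skew] coef ..
  \<comment> \<open>Row 8 drops out because \<open>y\<close> vanishes there, so the residual has to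
    be controlled only for \<open>i < 8\<close>.\<close>
  also have "(\<Sum>i<9. \<Sum>j<8. of_int (coefficient U i j) * y i j) = S"
  proof -
    have "{..<9::nat} = insert 8 {..<8}"
      by auto
    then show ?thesis
      by (simp add: S_def border)
  qed
  finally have "2 * \<bar>S\<bar> = \<bar>\<Sum>i<9. \<Sum>k<9. Re (V i k * E i k)\<bar>"
    by simp
  also have "\<dots> \<le> (\<Sum>i<9. \<Sum>k<9. \<bar>Re (V i k * E i k)\<bar>)"
    by (rule order_trans[OF sum_abs sum_mono[OF sum_abs]])
  also have "\<dots> \<le> (\<Sum>i<9. \<Sum>k<9. cmod (V i k) * e)"
  proof (intro sum_mono)
    fix i k :: nat
    assume "i \<in> {..<9}" "k \<in> {..<9}"
    \<comment> \<open>Hypothesis \<open>e\<close> covers distinct rows only; \<open>E i i\<close> is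
      zero.\<close>
    then have "cmod (E i k) \<le> e"
      using e[of i k] e0 by (cases "i = k") (auto simp: E_def)
    then show "\<bar>Re (V i k * E i k)\<bar> \<le> cmod (V i k) * e"
      by (metis abs_Re_le_cmod norm_mult mult_left_mono norm_ge_zero order_trans)
  qed
  also have "\<dots> \<le> 1140 * e"
    using mult_right_mono[OF c2 e0] by (simp add: sum_distrib_right)
  finally have S: "\<bar>S\<bar> \<le> 570 * e"
    by simp
  have "(\<Sum>i<8. \<Sum>j<8. of_int (\<delta> i j) * y i j)
      = (\<Sum>i<8. \<Sum>j<8. if i = 0 then (if j = r then 10 ^ 8 * y i j else 0) else 0)"
    by (intro sum.cong refl) (simp add: \<delta>_def)
  also have "\<dots> = (\<Sum>i<8. if i = 0 then (\<Sum>j<8. if j = r then 10 ^ 8 * y i j else 0) else 0)"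
    by (intro sum.cong refl) simp
  also have "\<dots> = 10 ^ 8 * y 0 r"
    using r by (simp add: sum.delta)
  finally have rep: "(\<Sum>i<8. \<Sum>j<8. of_int (\<delta> i j) * y i j) = 10 ^ 8 * y 0 r" .
  have "\<bar>S - 10 ^ 8 * y 0 r\<bar> = \<bar>\<Sum>i<8. \<Sum>j<8. (of_int (coefficient U i j) - of_int (\<delta> i j)) * y i j\<bar>"
    unfolding rep[symmetric] S_def by (simp only: sum_subtractf left_diff_distrib)
  also have "\<dots> \<le> (\<Sum>i<8. \<Sum>j<8. \<bar>(of_int (coefficient U i j) - of_int (\<delta> i j)) * y i j\<bar>)"
    by (rule order_trans[OF sum_abs sum_mono[OF sum_abs]])
  also have "\<dots> \<le> (\<Sum>i<8. \<Sum>j<8. \<bar>of_int (coefficient U i j) - of_int (\<delta> i j)\<bar> * M)"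
    by (intro sum_mono) (simp add: abs_mult mult_left_mono y)
  also have "\<dots> \<le> 45 * 10 ^ 6 * M"
    using mult_right_mono[OF c1 M] by (simp add: sum_distrib_right)
  finally show ?thesis
    using S by linarith
qed

section \<open>Rigidity of the core\<close>

text \<open>As before, index 8 is the row of ones.\<close>

definition core :: "(nat \<Rightarrow> complex) \<Rightarrow> nat \<Rightarrow> nat \<Rightarrow> complex" where
  "core f i j = (if i < 8 then f ((i + j) mod 8) else 1)"

text \<open>Expansion leaves two first-order errors and their product, which is absorbed because
  \<open>d \<le> 1\<close>; hence the factor 3.\<close>

lemma norm_mult_cnj_diff_le:
  fixes x x' z z' :: complex
  assumes "cmod x = 1" "cmod x' = 1" "cmod (z - x) \<le> d" "cmod (z' - x') \<le> d" "d \<le> 1"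
  shows "cmod (z * cnj z' - x * cnj x') \<le> 3 * d"
proof -
  have d: "0 \<le> d"
    using assms(3) norm_ge_zero order_trans by blast
  have "z * cnj z' - x * cnj x' = (z - x) * cnj (z' - x') + ((z - x) * cnj x' + x * cnj (z' - x'))"
    by (simp add: algebra_simps)
  also have "cmod \<dots> \<le> cmod (z - x) * cmod (z' - x') + (cmod (z - x) * cmod x' + cmod x * cmod (z' - x'))"
    by (intro order_trans[OF norm_triangle_ineq] add_mono) (simp_all only: norm_mult complex_mod_cnj order_refl)
  also have "\<dots> \<le> d * 1 + (d * 1 + 1 * d)"
    using assms d by (intro add_mono mult_mono) auto
  finally show ?thesis
    by simp
qed

lemma norm_sum_le_const:
  assumes "\<And>j. j < n \<Longrightarrow> norm (g j) \<le> (c::real)"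
  shows "norm (\<Sum>j<(n::nat). g j) \<le> of_nat n * c"
  using sum_norm_le[of "{..<n}" g "\<lambda>_. c"] assms by simp

text \<open>Rounding the core changes each equation by at most
  \<open>8 * (21 / 10000 * (2 * M))\<close>, and \<open>32 * M\<^sup>2\<close> is at most
  \<open>32 / 1000 * M\<close>; together they stay below \<open>66 / 1000 * M\<close>. The
  certificate then yields (0.45 + 0.3762) M, below 9/10 M.\<close>

lemma linearized_bound:
  fixes f :: "nat \<Rightarrow> complex" and y :: "nat \<Rightarrow> nat \<Rightarrow> real"
  assumes unit: "\<And>k. k < 8 \<Longrightarrow> cmod (f k) = 1"
    and f: "\<And>k. k < 8 \<Longrightarrow> cmod (Complex (of_int (core_re ! k)) (of_int (core_im ! k)) / 1000 - f k) \<le> 7 / 10000"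
    and border: "\<And>j. y 8 j = 0"
    and y: "\<And>i j. i < 8 \<Longrightarrow> j < 8 \<Longrightarrow> \<bar>y i j\<bar> \<le> M" and M: "M \<le> 1 / 1000"
    and e: "\<And>i k. i < 9 \<Longrightarrow> k < 9 \<Longrightarrow> i \<noteq> k \<Longrightarrow>
      cmod (\<Sum>j<8. core f i j * cnj (core f k j) * of_real (y i j - y k j)) \<le> 32 * M\<^sup>2"
    and r: "r < 4"
  shows "\<bar>y 0 r\<bar> \<le> 9 / 10 * M"
proof -
  obtain U where U: "certificate U r"
    using certificate_exists[OF r] .
  have M0: "0 \<le> M"
    using y[of 0 0] by simp
  have y9: "\<bar>y i j\<bar> \<le> M" if "i < 9" "j < 8" for i j
    using y[of i j] border[of j] M0 that by (cases "i = 8") auto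
  have unit': "cmod (core f i j) = 1" for i j
    by (simp add: core_def unit)
  have near: "cmod (approx i j / 1000 - core f i j) \<le> 7 / 10000" for i j
  proof (cases "i < 8")
    case True
    then show ?thesis
      using f[of "(i + j) mod 8"] by (simp add: approx_def approx_re_def approx_im_def core_def)
  next
    case False
    then have "approx i j / 1000 = core f i j"
      by (simp add: approx_def approx_re_def approx_im_def core_def complex_eq_iff)
    then show ?thesis
      by simp
  qed
  have "cmod (\<Sum>j<8. approx i j * cnj (approx k j) * of_real (y i j - y k j)) \<le> 10 ^ 6 * (66 / 1000 * M)"
    if ik: "i < 9" "k < 9" "i \<noteq> k" for i k
  proof -
    define D where "D j = approx i j / 1000 * cnj (approx k j / 1000) - core f i j * cnj (core f k j)" for j
    have "(\<Sum>j<8. approx i j * cnj (approx k j) * of_real (y i j - y k j))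
      = 10 ^ 6 * ((\<Sum>j<8. core f i j * cnj (core f k j) * of_real (y i j - y k j)) +
        (\<Sum>j<8. D j * of_real (y i j - y k j)))"
      unfolding D_def sum.distrib[symmetric] sum_distrib_left
      by (intro sum.cong refl) (simp add: field_simps)
    also have "cmod \<dots> \<le> 10 ^ 6 * (32 * M\<^sup>2 + 8 * (21 / 10000 * (2 * M)))"
    proof -
      have "cmod (\<Sum>j<8. D j * of_real (y i j - y k j)) \<le> of_nat 8 * (21 / 10000 * (2 * M))"
      proof (rule norm_sum_le_const)
        fix j :: nat
        assume j: "j < 8"
        have "cmod (D j) \<le> 3 * (7 / 10000)"
          unfolding D_def by (rule norm_mult_cnj_diff_le[OF unit' unit' near near]) simp
        moreover have "\<bar>y i j - y k j\<bar> \<le> 2 * M"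
          using y9[OF ik(1) j] y9[OF ik(2) j] by linarith
        ultimately show "cmod (D j * of_real (y i j - y k j)) \<le> 21 / 10000 * (2 * M)"
          unfolding norm_mult norm_of_real by (intro mult_mono) auto
      qed
      then have "cmod ((\<Sum>j<8. core f i j * cnj (core f k j) * of_real (y i j - y k j)) +
        (\<Sum>j<8. D j * of_real (y i j - y k j))) \<le> 32 * M\<^sup>2 + 8 * (21 / 10000 * (2 * M))"
        by (intro order_trans[OF norm_triangle_ineq] add_mono e ik) simp
      then have "(10 ^ 6 :: real) * cmod ((\<Sum>j<8. core f i j * cnj (core f k j) * of_real (y i j - y k j)) +
        (\<Sum>j<8. D j * of_real (y i j - y k j))) \<le> 10 ^ 6 * (32 * M\<^sup>2 + 8 * (21 / 10000 * (2 * M)))"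
        by (rule mult_left_mono) simp
      then show ?thesis
        by (simp only: norm_mult norm_power norm_numeral)
    qed
    also have "\<dots> \<le> 10 ^ 6 * (66 / 1000 * M)"
      using mult_right_mono[OF M M0] M0 by (simp add: power2_eq_square)
    finally show ?thesis .
  qed
  then have "10 ^ 8 * \<bar>y 0 r\<bar> \<le> 45 * 10 ^ 6 * M + 570 * (10 ^ 6 * (66 / 1000 * M))"
    using r by (intro certificate_bound[OF U] border y) auto
  then show ?thesis
    using M0 by simp
qed

lemma bij_betw_shift_mod:
  fixes n t :: nat
  assumes "0 < n"
  shows "bij_betw (\<lambda>j. (j + t) mod n) {..<n} {..<n}"
proof -
  have "inj_on (\<lambda>j. (j + t) mod n) {..<n}"
  proof (rule inj_onI)
    fix x y
    assume *: "x \<in> {..<n}" "y \<in> {..<n}" "(x + t) mod n = (y + t) mod n"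
    \<comment> \<open>Cancelling \<open>t\<close> needs subtraction, hence the passage to the
      integers.\<close>
    then have "(int x + int t) mod int n = (int y + int t) mod int n"
      by (simp flip: of_nat_add of_nat_mod)
    from mod_diff_cong[OF this refl, of "int t"] show "x = y"
      using * by simp
  qed
  moreover have "(\<lambda>j. (j + t) mod n) ` {..<n} \<subseteq> {..<n}"
    using assms by auto
  ultimately show ?thesis
    by (simp add: bij_betw_def endo_inj_surj)
qed

text \<open>A shift of the indices with \<open>p + t = 4\<close> conjugates the array, which is harmless because \<open>y\<close> is real.\<close>

lemma shifted_bound:
  fixes f :: "nat \<Rightarrow> complex" and y :: "nat \<Rightarrow> nat \<Rightarrow> real"
  assumes conj: "\<And>k. f ((k + 4) mod 8) = cnj (f (k mod 8))"
    and unit: "\<And>k. k < 8 \<Longrightarrow> cmod (f k) = 1"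
    and f: "\<And>k. k < 8 \<Longrightarrow> cmod (Complex (of_int (core_re ! k)) (of_int (core_im ! k)) / 1000 - f k) \<le> 7 / 10000"
    and border: "\<And>j. y 8 j = 0"
    and y: "\<And>i j. i < 8 \<Longrightarrow> j < 8 \<Longrightarrow> \<bar>y i j\<bar> \<le> M" and M: "M \<le> 1 / 1000"
    and e: "\<And>i k. i < 9 \<Longrightarrow> k < 9 \<Longrightarrow> i \<noteq> k \<Longrightarrow>
      cmod (\<Sum>j<8. core f i j * cnj (core f k j) * of_real (y i j - y k j)) \<le> 32 * M\<^sup>2"
    and p: "p < 8" and q: "q < 8"
  shows "\<bar>y p q\<bar> \<le> 9 / 10 * M"
proof -
  \<comment> \<open>Modulo 8, \<open>t\<close> is q - r, so column \<open>r\<close> moves to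
    \<open>q\<close>, and p + t becomes p + q - r, a multiple of 4. The summand 8 avoids truncated
    subtraction.\<close>
  define r where "r = (p + q) mod 4"
  define t where "t = q + (8 - r)"
  have t2: "(r + t) mod 8 = q"
    using q by (simp add: t_def r_def)
  have t1: "(p + t) mod 8 \<in> {0, 4}"
  proof -
    have "4 * ((p + q) div 4) + r = p + q" "r < 4"
      by (simp_all add: r_def)
    then have "p + t = 4 * ((p + q) div 4 + 2)"
      by (simp add: t_def)
    also have "\<dots> mod 8 = 4 * (((p + q) div 4 + 2) mod 2)"
      using mult_mod_right[of 4 "(p + q) div 4 + 2" 2] by simp
    finally show ?thesis
      by (simp add: mod2_eq_if)
  qed
  define c where "c = (if (p + t) mod 8 = 0 then id else cnj)"
  \<comment> \<open>The row of ones stays fixed; only the eight core rows are shifted.\<close>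
  define \<sigma> where "\<sigma> i = (if i < 8 then (i + p) mod 8 else i)" for i
  define y' where "y' i j = y (\<sigma> i) ((j + t) mod 8)" for i j
  have c: "c (z * w) = c z * c w" "c (cnj z) = cnj (c z)" "c (of_real x) = of_real x"
    "cmod (c z) = cmod z" "c 1 = 1" for z w x
    by (auto simp: c_def)
  have c_sum: "c (\<Sum>j\<in>A. g j) = (\<Sum>j\<in>A. c (g j))" for g :: "nat \<Rightarrow> complex" and A
    by (auto simp: c_def)
  have core: "core f (\<sigma> i) ((j + t) mod 8) = c (core f i j)" for i j
  proof (cases "i < 8")
    case True
    have "((i + p) mod 8 + (j + t) mod 8) mod 8 = (i + j + (p + t) mod 8) mod 8"
      by (simp only: mod_add_left_eq mod_add_right_eq) (simp only: ac_simps)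
    moreover have "f ((i + j + (p + t) mod 8) mod 8) = c (f ((i + j) mod 8))"
      using t1 conj[of "i + j"] by (auto simp: c_def)
    ultimately show ?thesis
      using True by (simp add: core_def \<sigma>_def)
  next
    case False
    then show ?thesis
      by (simp add: core_def \<sigma>_def c)
  qed
  have \<sigma>: "\<sigma> i < 9" "i < 8 \<Longrightarrow> \<sigma> i < 8" "\<sigma> 8 = 8" if "i < 9" for i
    using that mod_less_divisor[of 8 "i + p"] by (auto simp: \<sigma>_def simp del: mod_less_divisor)
  have \<sigma>_inj: "\<sigma> i \<noteq> \<sigma> k" if "i < 9" "k < 9" "i \<noteq> k" for i k
  proof -
    have "(i + p) mod 8 \<noteq> (k + p) mod 8" if "i < 8" "k < 8"
      using bij_betw_imp_inj_on[OF bij_betw_shift_mod[of 8 p]] that \<open>i \<noteq> k\<close>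
      by (auto dest: inj_onD)
    then show ?thesis
      using that mod_less_divisor[of 8 "i + p"] mod_less_divisor[of 8 "k + p"]
      by (auto simp: \<sigma>_def)
  qed
  have "cmod (\<Sum>j<8. core f i j * cnj (core f k j) * of_real (y' i j - y' k j)) \<le> 32 * M\<^sup>2"
    if ik: "i < 9" "k < 9" "i \<noteq> k" for i k
  proof -
    have "cmod (\<Sum>j<8. core f i j * cnj (core f k j) * of_real (y' i j - y' k j))
      = cmod (\<Sum>j<8. c (core f i j * cnj (core f k j) * of_real (y' i j - y' k j)))"
      by (simp only: c_sum[symmetric] c(4))
    also have "(\<Sum>j<8. c (core f i j * cnj (core f k j) * of_real (y' i j - y' k j)))
      = (\<Sum>j<8. (\<lambda>j. core f (\<sigma> i) j * cnj (core f (\<sigma> k) j) * of_real (y (\<sigma> i) j - y (\<sigma> k) j)) ((j + t) mod 8))"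
      by (simp only: c core y'_def)
    also have "\<dots> = (\<Sum>j<8. core f (\<sigma> i) j * cnj (core f (\<sigma> k) j) * of_real (y (\<sigma> i) j - y (\<sigma> k) j))"
      by (rule sum.reindex_bij_betw[OF bij_betw_shift_mod]) simp
    also have "cmod \<dots> \<le> 32 * M\<^sup>2"
      using ik by (intro e \<sigma> \<sigma>_inj)
    finally show ?thesis .
  qed
  moreover have "\<bar>y' i j\<bar> \<le> M" if "i < 8" "j < 8" for i j
    unfolding y'_def using that by (intro y \<sigma>) auto
  moreover have "y' 8 j = 0" for j
    by (simp add: y'_def \<sigma>_def border)
  moreover have "r < 4"
    by (simp add: r_def)
  ultimately have "\<bar>y' 0 r\<bar> \<le> 9 / 10 * M"
    using M by (intro linearized_bound[OF unit f])
  moreover have "y' 0 r = y p q"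
    using t2 p by (simp add: y'_def \<sigma>_def)
  ultimately show ?thesis
    by simp
qed

text \<open>The error is the real number \<open>1 - Re u\<close>, which is at most
  \<open>(1 - Re u) * (1 + Re u) = (Im u)\<^sup>2\<close>.\<close>

lemma unit_expansion:
  assumes "cmod u = 1" "0 \<le> Re u"
  shows "cmod (u - (1 + \<i> * of_real (Im u))) \<le> (Im u)\<^sup>2"
proof -
  have sq: "(Re u)\<^sup>2 + (Im u)\<^sup>2 = 1"
    using assms(1) by (metis cmod_power2 one_power2)
  then have "Re u \<le> 1"
    using assms(1) complex_Re_le_cmod[of u] by simp
  have "u - (1 + \<i> * of_real (Im u)) = of_real (Re u - 1)"
    by (simp add: complex_eq_iff)
  then have "cmod (u - (1 + \<i> * of_real (Im u))) = 1 - Re u"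
    using \<open>Re u \<le> 1\<close> by (simp only: norm_of_real)
  also have "\<dots> \<le> (Im u)\<^sup>2"
    using sq mult_nonneg_nonneg[of "Re u" "1 - Re u"] assms(2) \<open>Re u \<le> 1\<close>
    by (simp add: power2_eq_square algebra_simps)
  finally show ?thesis .
qed

text \<open>The product of the imaginary parts contributes \<open>M\<^sup>2\<close>, the remainder
  of \<open>u\<close> as much again, and that of \<open>v\<close> twice as much because its cofactor
  has modulus at most 2.\<close>

lemma unit_pair_expansion:
  assumes u: "cmod u = 1" "0 \<le> Re u" "\<bar>Im u\<bar> \<le> M" and v: "cmod v = 1" "0 \<le> Re v" "\<bar>Im v\<bar> \<le> M"
    and M: "M \<le> 1"
  shows "cmod (u * cnj v - 1 - \<i> * of_real (Im u - Im v)) \<le> 4 * M\<^sup>2"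
proof -
  define a where "a = u - (1 + \<i> * of_real (Im u))"
  define b where "b = v - (1 + \<i> * of_real (Im v))"
  have sq: "(Im u)\<^sup>2 \<le> M\<^sup>2" "(Im v)\<^sup>2 \<le> M\<^sup>2"
    using u(3) v(3) by (simp_all add: abs_le_square_iff[symmetric])
  have ab: "cmod a \<le> M\<^sup>2" "cmod b \<le> M\<^sup>2"
    unfolding a_def b_def using unit_expansion[OF u(1,2)] unit_expansion[OF v(1,2)] sq by linarith+
  have "cmod (1 + \<i> * of_real (Im u)) \<le> 2"
    using norm_triangle_ineq[of 1 "\<i> * of_real (Im u)"] u(3) M by (simp add: norm_mult)
  have "u * cnj v - 1 - \<i> * of_real (Im u - Im v)
    = of_real (Im u * Im v) + (a * cnj v + (1 + \<i> * of_real (Im u)) * cnj b)"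
    by (simp add: a_def b_def algebra_simps)
  also have "cmod \<dots> \<le> \<bar>Im u\<bar> * \<bar>Im v\<bar> + (cmod a * cmod v + cmod (1 + \<i> * of_real (Im u)) * cmod b)"
    by (intro order_trans[OF norm_triangle_ineq] add_mono)
      (simp_all only: norm_mult norm_of_real abs_mult complex_mod_cnj order_refl)
  also have "\<dots> \<le> M * M + (M\<^sup>2 * 1 + 2 * M\<^sup>2)"
    using u v ab \<open>cmod (1 + \<i> * of_real (Im u)) \<le> 2\<close> by (intro add_mono mult_mono) auto
  finally show ?thesis
    by (simp add: power2_eq_square)
qed

text \<open>\<open>u\<close> is the entrywise quotient of a nearby normalised array by the core.
  Subtracting the two orthogonality relations leaves the linearised equation up to eight errors of
  size \<open>4 * M\<^sup>2\<close>. Applying \<open>shifted_bound\<close> where the maximum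
  \<open>M\<close> is attained forces \<open>M = 0\<close>.\<close>

lemma core_rigid:
  fixes f :: "nat \<Rightarrow> complex" and u :: "nat \<Rightarrow> nat \<Rightarrow> complex"
  assumes conj: "\<And>k. f ((k + 4) mod 8) = cnj (f (k mod 8))"
    and unit: "\<And>k. k < 8 \<Longrightarrow> cmod (f k) = 1"
    and f: "\<And>k. k < 8 \<Longrightarrow> cmod (Complex (of_int (core_re ! k)) (of_int (core_im ! k)) / 1000 - f k) \<le> 7 / 10000"
    and orth: "\<And>i k. i < 9 \<Longrightarrow> k < 9 \<Longrightarrow> i \<noteq> k \<Longrightarrow> (\<Sum>j<8. core f i j * cnj (core f k j)) = -1"
    and orth': "\<And>i k. i < 9 \<Longrightarrow> k < 9 \<Longrightarrow> i \<noteq> k \<Longrightarrow>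
      (\<Sum>j<8. core f i j * cnj (core f k j) * (u i j * cnj (u k j))) = -1"
    and border: "\<And>j. u 8 j = 1"
    and u: "\<And>i j. i < 8 \<Longrightarrow> j < 8 \<Longrightarrow> cmod (u i j) = 1"
    and near: "\<And>i j. i < 8 \<Longrightarrow> j < 8 \<Longrightarrow> cmod (u i j - 1) \<le> 1 / 1000"
    and ij: "i < 8" "j < 8"
  shows "u i j = 1"
proof -
  define y where "y i j = Im (u i j)" for i j
  define A where "A = (\<lambda>(i, j). \<bar>y i j\<bar>) ` ({..<8} \<times> {..<8})"
  define M where "M = Max A"
  have A: "finite A" "A \<noteq> {}"
    by (auto simp: A_def lessThan_empty_iff)
  have yM: "\<bar>y i j\<bar> \<le> M" if "i < 8" "j < 8" for i j
    unfolding M_def using A that by (intro Max_ge) (auto simp: A_def)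
  obtain p q where pq: "p < 8" "q < 8" "M = \<bar>y p q\<bar>"
    using Max_in[OF A] by (auto simp: A_def M_def)
  have y_near: "\<bar>y i j\<bar> \<le> 1 / 1000" if "i < 8" "j < 8" for i j
    using near[OF that] abs_Im_le_cmod[of "u i j - 1"] by (simp add: y_def)
  have M: "M \<le> 1 / 1000"
    unfolding pq(3) by (rule y_near[OF pq(1,2)])
  have M0: "0 \<le> M"
    by (simp add: pq)
  have Re_u: "0 \<le> Re (u i j)" if "i < 8" "j < 8" for i j
    using near[OF that] abs_Re_le_cmod[of "u i j - 1"] by simp
  have u9: "cmod (u i j) = 1 \<and> 0 \<le> Re (u i j) \<and> \<bar>Im (u i j)\<bar> \<le> M" if "i < 9" "j < 8" for i j
    using that u[of i j] Re_u[of i j] yM[of i j] border[of j] M0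
    by (cases "i = 8") (auto simp: y_def)
  have unit': "cmod (core f i j) = 1" for i j
    by (simp add: core_def unit)
  have "cmod (\<Sum>j<8. core f i j * cnj (core f k j) * of_real (y i j - y k j)) \<le> 32 * M\<^sup>2"
    if ik: "i < 9" "k < 9" "i \<noteq> k" for i k
  proof -
    define g where "g j = core f i j * cnj (core f k j)" for j
    define h where "h j = u i j * cnj (u k j) - 1 - \<i> * of_real (y i j - y k j)" for j
    have "(\<Sum>j<8. g j * (u i j * cnj (u k j) - 1)) = 0"
      using orth[OF ik] orth'[OF ik] by (simp add: g_def right_diff_distrib sum_subtractf)
    moreover have "(\<Sum>j<8. g j * h j) = (\<Sum>j<8. g j * (u i j * cnj (u k j) - 1))
        - \<i> * (\<Sum>j<8. g j * of_real (y i j - y k j))"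
      unfolding h_def sum_distrib_left sum_subtractf[symmetric]
      by (intro sum.cong refl) (simp add: algebra_simps)
    ultimately have "(\<Sum>j<8. g j * h j) = - \<i> * (\<Sum>j<8. g j * of_real (y i j - y k j))"
      by simp
    then have "cmod (\<Sum>j<8. g j * of_real (y i j - y k j)) = cmod (\<Sum>j<8. g j * h j)"
      by (simp only: norm_mult norm_minus_cancel norm_ii mult_1_left)
    also have "\<dots> \<le> of_nat 8 * (4 * M\<^sup>2)"
    proof (rule norm_sum_le_const)
      fix j :: nat
      assume "j < 8"
      then have "cmod (h j) \<le> 4 * M\<^sup>2"
        unfolding h_def y_def using u9[of i j] u9[of k j] ik M
        by (intro unit_pair_expansion) auto
      then show "cmod (g j * h j) \<le> 4 * M\<^sup>2"
        by (simp add: g_def norm_mult unit')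
    qed
    finally show ?thesis
      by (simp add: g_def)
  qed
  moreover have "y 8 j = 0" for j
    by (simp add: y_def border)
  ultimately have "\<bar>y p q\<bar> \<le> 9 / 10 * M"
    using yM M pq(1,2) by (intro shifted_bound[OF conj unit f])
  then have "M = 0"
    using pq(3) by simp
  then have "Im (u i j) = 0"
    using yM[OF ij] by (simp add: y_def)
  then show ?thesis
    using unit_expansion[OF u[OF ij] Re_u[OF ij]] by simp
qed

section \<open>Equivalence of Hadamard matrices\<close>

text \<open>Unimodular entries settle the diagonal of the product, leaving pairs of distinct
  rows.\<close>

lemma complex_hadamard_iff:
  fixes H :: "complex^'n^'n"
  shows "complex_hadamard H \<longleftrightarrow> (\<forall>i j. cmod (H $ i $ j) = 1) \<and>
    (\<forall>i k. i \<noteq> k \<longrightarrow> (\<Sum>j\<in>UNIV. H $ i $ j * cnj (H $ k $ j)) = 0)"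
proof -
  have "H ** conj_transpose H = mat (of_nat CARD('n)) \<longleftrightarrow>
      (\<forall>i k. (\<Sum>j\<in>UNIV. H $ i $ j * cnj (H $ k $ j)) = (if i = k then of_nat CARD('n) else 0))"
    by (simp add: vec_eq_iff matrix_matrix_mult_def mat_def conj_transpose_def map_matrix_def transpose_def)
  moreover have "(\<Sum>j\<in>UNIV. H $ i $ j * cnj (H $ i $ j)) = of_nat CARD('n)"
    if "\<forall>i j. cmod (H $ i $ j) = 1" for i
    using that by (simp add: complex_norm_square[symmetric])
  ultimately show ?thesis
    unfolding complex_hadamard_def by metis
qed

text \<open>Close to \<open>Y9C\<close> it suffices to rescale rows and columns, so both
  permutations are the identity.\<close>

lemma hadamard_equivI:
  fixes H K :: "complex^'n^'n"
  assumes x: "\<And>i. cmod (x i) = 1" and z: "\<And>j. cmod (z j) = 1"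
    and K: "\<And>i j. K $ i $ j = x i * H $ i $ j * z j"
  shows "hadamard_equiv K H"
proof -
  define D :: "('n \<Rightarrow> complex) \<Rightarrow> complex^'n^'n" where "D w = (\<chi> i j. if i = j then w i else 0)" for w
  have D: "diagonal_matrix (D w)" "unitary_matrix (D w)" if "\<And>i. cmod (w i) = 1" for w
  proof -
    have "w i * cnj (w i) = 1" for i
      using that[of i] by (simp add: complex_norm_square[symmetric])
    moreover from this have "cnj (w i) * w i = 1" for i
      by (simp add: mult.commute)
    ultimately show "unitary_matrix (D w)"
      by (simp add: unitary_matrix_def D_def matrix_matrix_mult_def conj_transpose_def map_matrix_def
        transpose_def mat_def vec_eq_iff if_distrib[of cnj] if_distribR if_distrib[of "(*) _"] sum.delta cong: if_cong)
    show "diagonal_matrix (D w)"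
      by (simp add: diagonal_matrix_def D_def)
  qed
  have "permutation_matrix (mat 1 :: complex^'n^'n)"
    unfolding permutation_matrix_def mat_def by (intro exI[of _ id]) simp
  moreover have "K = D x ** mat 1 ** H ** mat 1 ** D z"
    unfolding matrix_mul_rid
    by (simp add: vec_eq_iff matrix_matrix_mult_def D_def K mult_delta_left mult_delta_right)
  ultimately show ?thesis
    unfolding hadamard_equiv_def using D x z by blast
qed

lemma norm_mult_diff_le:
  fixes w x y z :: complex
  assumes "cmod x = 1" "cmod y = 1"
  shows "cmod (w * x - y * z) \<le> cmod (w - y) + cmod (x - z)"
proof -
  have "w * x - y * z = (w - y) * x + y * (x - z)"
    by (simp add: algebra_simps)
  also have "cmod \<dots> \<le> cmod ((w - y) * x) + cmod (y * (x - z))"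
    by (rule norm_triangle_ineq)
  finally show ?thesis
    by (simp add: norm_mult assms)
qed

section \<open>The matrix\<close>

definition core_values :: "nat \<Rightarrow> complex" where
  "core_values k = [Y9C_a, Y9C_b, Y9C_d, Y9C_c, cnj Y9C_a, cnj Y9C_b, cnj Y9C_d, cnj Y9C_c] ! k"

lemma less_8_cases: "k < 8 \<Longrightarrow> k \<in> {0, 1, 2, 3, 4, 5, 6, 7::nat}"
  by auto

lemma less_9_cases: "k < 9 \<Longrightarrow> k \<in> {0, 1, 2, 3, 4, 5, 6, 7, 8::nat}"
  by auto

lemma sum_lessThan_8: "(\<Sum>k<8. g k) = g 0 + g 1 + g 2 + g 3 + g 4 + g 5 + g 6 + g (7::nat)"
  by (simp add: eval_nat_numeral)

lemma core_values_conj: "core_values ((k + 4) mod 8) = cnj (core_values (k mod 8))"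
proof -
  have "core_values ((m + 4) mod 8) = cnj (core_values m)" if "m < 8" for m
    using less_8_cases[OF that] by (auto simp: core_values_def)
  from this[of "k mod 8"] show ?thesis
    by (simp add: mod_simps)
qed

lemma norm_core_values: "k < 8 \<Longrightarrow> cmod (core_values k) = 1"
  using less_8_cases[of k] g_less_1
  by (auto simp: core_values_def Y9C_eq cmod_def)

lemma norm_le_of_components:
  assumes "\<bar>Re z\<bar> \<le> x" "\<bar>Im z\<bar> \<le> y" "x\<^sup>2 + y\<^sup>2 \<le> d\<^sup>2" "0 \<le> d"
  shows "cmod z \<le> d"
proof -
  have "(Re z)\<^sup>2 \<le> x\<^sup>2" "(Im z)\<^sup>2 \<le> y\<^sup>2"
    using assms(1,2) by (simp_all add: abs_le_square_iff[symmetric])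
  then show ?thesis
    unfolding cmod_def using assms(3,4) by (intro real_le_lsqrt) auto
qed

text \<open>The bounds are on the absolute value because \<open>g3\<close> is negative.\<close>

lemma sine_enclosure:
  fixes g :: real
  assumes "l \<le> \<bar>g\<bar>" "\<bar>g\<bar> \<le> u" "0 \<le> l" "L\<^sup>2 \<le> 1 - u\<^sup>2" "1 - l\<^sup>2 \<le> U\<^sup>2" "0 \<le> U"
  shows "L \<le> sqrt (1 - g\<^sup>2) \<and> sqrt (1 - g\<^sup>2) \<le> U"
proof -
  have "l\<^sup>2 \<le> g\<^sup>2" "g\<^sup>2 \<le> u\<^sup>2"
    using assms(1-3) by (simp_all add: abs_le_square_iff[symmetric])
  then show ?thesis
    using assms by (auto intro!: real_le_rsqrt real_le_lsqrt)
qed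

lemma core_values_near:
  assumes "k < 8"
  shows "cmod (Complex (of_int (core_re ! k)) (of_int (core_im ! k)) / 1000 - core_values k) \<le> 7 / 10000"
proof -
  have 1: "94055 / 100000 \<le> sqrt (1 - g1\<^sup>2) \<and> sqrt (1 - g1\<^sup>2) \<le> 94058 / 100000"
    by (rule sine_enclosure[of "33962 / 100000" g1 "33963 / 100000"])
      (use g_enclosure in \<open>simp_all add: power2_eq_square\<close>)
  have 2: "26760 / 100000 \<le> sqrt (1 - g2\<^sup>2) \<and> sqrt (1 - g2\<^sup>2) \<le> 26770 / 100000"
    by (rule sine_enclosure[of "96351 / 100000" g2 "96352 / 100000"])
      (use g_enclosure in \<open>simp_all add: power2_eq_square\<close>)
  have 3: "99932 / 100000 \<le> sqrt (1 - g3\<^sup>2) \<and> sqrt (1 - g3\<^sup>2) \<le> 99934 / 100000"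
    by (rule sine_enclosure[of "3648 / 100000" g3 "3649 / 100000"])
      (use g_enclosure in \<open>simp_all add: power2_eq_square\<close>)
  have 4: "54315 / 100000 \<le> sqrt (1 - g4\<^sup>2) \<and> sqrt (1 - g4\<^sup>2) \<le> 54319 / 100000"
    by (rule sine_enclosure[of "83962 / 100000" g4 "83963 / 100000"])
      (use g_enclosure in \<open>simp_all add: power2_eq_square\<close>)
  \<comment> \<open>In units of 1/100000, 50 and 46 bound the rounding errors of the two parts, and
    \<open>50\<^sup>2 + 46\<^sup>2 < 70\<^sup>2\<close>.\<close>
  show ?thesis
    by (rule norm_le_of_components[of _ "50 / 100000" "46 / 100000"])
      (use less_8_cases[OF assms] g_enclosure 1 2 3 4 in
        \<open>auto simp: core_values_def core_re_def core_im_def Y9C_eq power2_eq_square\<close>)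
qed

section \<open>Autocorrelations and orthogonality of the rows\<close>

lemma sum_core_values: "(\<Sum>k<8. core_values k) = -1"
  using g_relations by (simp add: sum_lessThan_8 core_values_def Y9C_eq complex_eq_iff)

text \<open>The conjugation symmetry makes the sums real. Odd shifts use \<open>r1\<close> and the
  sine relation \<open>r2\<close>, shifts 2 and 6 the product relation, and shift 4 the sum of
  squares.\<close>

lemma core_values_autocorrelation:
  assumes "m < 8" "m \<noteq> 0"
  shows "(\<Sum>k<8. core_values ((k + m) mod 8) * cnj (core_values k)) = -1"
proof -
  define sa where "sa = sqrt (1 - g1\<^sup>2)"
  define sb where "sb = sqrt (1 - g2\<^sup>2)"
  define sc where "sc = sqrt (1 - g3\<^sup>2)"
  define sd where "sd = sqrt (1 - g4\<^sup>2)"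
  have sq: "sa * sa = 1 - g1 * g1" "sb * sb = 1 - g2 * g2" "sc * sc = 1 - g3 * g3" "sd * sd = 1 - g4 * g4"
    using g_less_1 by (simp_all add: sa_def sb_def sc_def sd_def power2_eq_square)
  have "g3 - g2 = - 1"
    using g_relations(2) by simp
  then have "(g4 - g1) * (g3 - g2) = - 1 / 2"
    by (simp only: g_relations(1))
  then have r1: "g4 * g3 - g4 * g2 - g1 * g3 + g1 * g2 = - 1 / 2"
    by (simp add: algebra_simps)
  have r2: "sb * sa + sb * sd = sc * sa - sc * sd"
    using sine_relation by (simp add: sa_def sb_def sc_def sd_def algebra_simps)
  have r3: "g1 * g4 + g2 * g3 = 1 / 4" "g1 * g1 + g2 * g2 + g3 * g3 + g4 * g4 = 7 / 4"
    using g_relations by (simp_all add: power2_eq_square)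
  have entries: "Y9C_a = Complex (- g1) sa" "Y9C_b = Complex (- g2) sb"
    "Y9C_c = Complex g3 sc" "Y9C_d = Complex g4 sd"
    by (simp_all add: Y9C_eq sa_def sb_def sc_def sd_def)
  have "m \<in> {1, 2, 3, 4, 5, 6, 7}"
    using assms by auto
  then show ?thesis
    using sq r1 r2 r3
    by (elim insertE emptyE; simp add: sum_lessThan_8 core_values_def entries complex_eq_iff algebra_simps)
qed

text \<open>The value -1 offsets the omitted column of ones. Two core rows give the autocorrelation
  at shift i - k modulo 8; a core row against the row of ones gives the plain sum or its
  conjugate.\<close>

lemma core_orthogonal:
  assumes ik: "i < 9" "k < 9" "i \<noteq> k"
  shows "(\<Sum>j<8. core core_values i j * cnj (core core_values k j)) = -1"
proof -
  have shift: "(\<Sum>j<8. g ((j + t) mod 8)) = (\<Sum>j<8. g j)" for g :: "nat \<Rightarrow> complex" and t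
    by (rule sum.reindex_bij_betw[OF bij_betw_shift_mod]) simp
  have row_sum: "(\<Sum>j<8. core_values ((i + j) mod 8)) = -1" for i
    using shift[of core_values i] sum_core_values by (simp add: add.commute)
  have row_sum_cnj: "(\<Sum>j<8. cnj (core_values ((i + j) mod 8))) = -1" for i
    using arg_cong[OF row_sum[of i], of cnj] by (simp add: cnj_sum)
  consider "i < 8" "k < 8" | "i = 8" "k < 8" | "i < 8" "k = 8"
    using ik by linarith
  then show ?thesis
  proof cases
    case 1
    define m where "m = (i + (8 - k)) mod 8"
    have m: "m < 8" "m \<noteq> 0"
    proof -
      have "m = (if k \<le> i then i - k else i + (8 - k))"
        using 1 by (auto simp: m_def mod_if)
      then show "m \<noteq> 0"
        using 1 ik by (auto split: if_splits)
    qed (simp add: m_def)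
    have "(i + j) mod 8 = ((j + k) mod 8 + m) mod 8" for j
    proof -
      have "((j + k) mod 8 + m) mod 8 = (j + k + (i + (8 - k))) mod 8"
        by (simp only: m_def mod_add_eq)
      also have "j + k + (i + (8 - k)) = i + j + 8"
        using 1 by simp
      finally show ?thesis
        by simp
    qed
    then have "(\<Sum>j<8. core core_values i j * cnj (core core_values k j))
      = (\<Sum>j<8. (\<lambda>l. core_values ((l + m) mod 8) * cnj (core_values l)) ((j + k) mod 8))"
      using 1 by (simp add: core_def add.commute[of k])
    then show ?thesis
      using shift[of "\<lambda>l. core_values ((l + m) mod 8) * cnj (core_values l)"]
        core_values_autocorrelation[OF m] by simp
  qed (simp_all add: core_def row_sum row_sum_cnj)
qed

section \<open>Identification of \<open>Y9C\<close> with the bordered array\<close>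

text \<open>The orders of the rows and columns that turn the core of \<open>Y\<^sub>9\<^sub>C\<close> into \<open>f (i + j)\<close>; index 1 comes last.\<close>

definition row_index :: "nat \<Rightarrow> 9" where
  "row_index i = [2, 3, 6, 4, 7, 5, 9, 8, 1] ! i"

definition col_index :: "nat \<Rightarrow> 9" where
  "col_index j = [2, 8, 3, 7, 4, 6, 9, 5, 1] ! j"

lemma vector_9:
  "(vector [x1, x2, x3, x4, x5, x6, x7, x8, x9] :: 'a::zero^9) $ 1 = x1"
  "(vector [x1, x2, x3, x4, x5, x6, x7, x8, x9] :: 'a::zero^9) $ 2 = x2"
  "(vector [x1, x2, x3, x4, x5, x6, x7, x8, x9] :: 'a::zero^9) $ 3 = x3"
  "(vector [x1, x2, x3, x4, x5, x6, x7, x8, x9] :: 'a::zero^9) $ 4 = x4"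
  "(vector [x1, x2, x3, x4, x5, x6, x7, x8, x9] :: 'a::zero^9) $ 5 = x5"
  "(vector [x1, x2, x3, x4, x5, x6, x7, x8, x9] :: 'a::zero^9) $ 6 = x6"
  "(vector [x1, x2, x3, x4, x5, x6, x7, x8, x9] :: 'a::zero^9) $ 7 = x7"
  "(vector [x1, x2, x3, x4, x5, x6, x7, x8, x9] :: 'a::zero^9) $ 8 = x8"
  "(vector [x1, x2, x3, x4, x5, x6, x7, x8, x9] :: 'a::zero^9) $ 9 = x9"
  unfolding vector_def by simp_all

lemma bij_betw_nth_UNIV:
  assumes "distinct xs" "length xs = n" "n = CARD('a::finite)"
  shows "bij_betw ((!) (xs :: 'a list)) {..<n} UNIV"
proof -
  have "set xs = UNIV"
    using assms by (intro card_eq_UNIV_imp_eq_UNIV) (simp_all add: distinct_card)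
  then show ?thesis
    using bij_betw_nth[OF assms(1) refl refl] assms(2) by simp
qed

lemma bij_row_index: "bij_betw row_index {..<9} UNIV"
  unfolding row_index_def[abs_def] by (rule bij_betw_nth_UNIV) simp_all

lemma bij_col_index: "bij_betw col_index {..<9} UNIV"
  unfolding col_index_def[abs_def] by (rule bij_betw_nth_UNIV) simp_all

lemma Y9C_entry:
  assumes "i < 9" "j < 9"
  shows "Y9C $ row_index i $ col_index j = (if j < 8 then core core_values i j else 1)"
  using less_9_cases[OF assms(1)] less_9_cases[OF assms(2)]
  by (elim insertE emptyE;
    simp add: row_index_def col_index_def Y9C_def Let_def vector_9 core_def core_values_def)

lemma sum_col_index:
  fixes g :: "9 \<Rightarrow> complex"
  shows "(\<Sum>j\<in>UNIV. g j) = (\<Sum>j<8. g (col_index j)) + g (col_index 8)"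
proof -
  have "(\<Sum>j\<in>UNIV. g j) = (\<Sum>j<9. g (col_index j))"
    by (rule sum.reindex_bij_betw[OF bij_col_index, symmetric])
  also have "{..<9::nat} = insert 8 {..<8}"
    by auto
  finally show ?thesis
    by simp
qed

lemma row_index_cases:
  obtains i' where "i' < 9" "i = row_index i'"
proof -
  have "i \<in> row_index ` {..<9}"
    by (simp add: bij_betw_imp_surj_on[OF bij_row_index])
  then show thesis
    using that by blast
qed

lemma col_index_cases:
  obtains j' where "j' < 9" "j = col_index j'"
proof -
  have "j \<in> col_index ` {..<9}"
    by (simp add: bij_betw_imp_surj_on[OF bij_col_index])
  then show thesis
    using that by blast
qed

lemma norm_core: "cmod (core core_values i j) = 1"
  by (simp add: core_def norm_core_values)

lemma complex_hadamard_Y9C: "complex_hadamard Y9C"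
  unfolding complex_hadamard_iff
proof (intro conjI allI impI)
  fix i j
  show "cmod (Y9C $ i $ j) = 1"
    by (rule row_index_cases[of i], rule col_index_cases[of j]) (simp add: Y9C_entry norm_core)
next
  fix i k :: 9
  assume "i \<noteq> k"
  obtain i' where "i' < 9" "i = row_index i'"
    by (rule row_index_cases)
  moreover obtain k' where "k' < 9" "k = row_index k'"
    by (rule row_index_cases)
  moreover from calculation have "i' \<noteq> k'"
    using \<open>i \<noteq> k\<close> by auto
  ultimately show "(\<Sum>j\<in>UNIV. Y9C $ i $ j * cnj (Y9C $ k $ j)) = 0"
    using core_orthogonal[of i' k'] by (simp add: sum_col_index Y9C_entry)
qed

text \<open>Rescaling \<open>K\<close> to \<open>d\<close> makes its last row and column equal to 1.
  By \<open>core_rigid\<close> the quotient \<open>u\<close> is 1 on the core, and undoing the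
  rescaling exhibits the equivalence.\<close>

lemma rigid_Y9C:
  assumes K: "complex_hadamard K" and near: "\<And>i j. cmod (K $ i $ j - Y9C $ i $ j) \<le> 1 / 4000"
  shows "hadamard_equiv K Y9C"
proof -
  define k where "k i j = K $ row_index i $ col_index j" for i j
  define d where "d i j = k i j * cnj (k i 8) * (cnj (k 8 j) * k 8 8)" for i j
  define u where "u i j = d i j * cnj (core core_values i j)" for i j
  have unit: "cmod (k i j) = 1" for i j
    using K by (simp add: k_def complex_hadamard_def)
  have unit': "k i j * cnj (k i j) = 1" "cnj (k i j) * k i j = 1" for i j
    using unit[of i j] by (simp_all add: complex_norm_square[symmetric] mult.commute)
  have core1: "core core_values i j * cnj (core core_values i j) = 1" for i j
    using norm_core[of i j] by (simp add: complex_norm_square[symmetric])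
  have k_near: "cmod (k i j - (if j < 8 then core core_values i j else 1)) \<le> 1 / 4000" if "i < 9" "j < 9" for i j
    using near[of "row_index i" "col_index j"] that by (simp add: k_def Y9C_entry)
  have u_core: "core core_values i j * u i j = d i j" for i j
    using core1[of i j] by (simp add: u_def mult_ac)
  have u1: "u i j = 1" if "i < 8" "j < 8" for i j
  proof (rule core_rigid[OF core_values_conj norm_core_values core_values_near core_orthogonal _ _ _ _ that])
    fix i l :: nat
    assume il: "i < 9" "l < 9" "i \<noteq> l"
    have "row_index i \<noteq> row_index l"
      using bij_betw_imp_inj_on[OF bij_row_index] il by (auto dest: inj_onD)
    then have "(\<Sum>j\<in>UNIV. K $ row_index i $ j * cnj (K $ row_index l $ j)) = 0"
      using K by (simp add: complex_hadamard_iff)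
    then have *: "(\<Sum>j<8. k i j * cnj (k l j)) = - (k i 8 * cnj (k l 8))"
      by (simp add: sum_col_index k_def add_eq_0_iff)
    have "(\<Sum>j<8. core core_values i j * cnj (core core_values l j) * (u i j * cnj (u l j)))
      = (\<Sum>j<8. d i j * cnj (d l j))"
      by (simp add: u_core[symmetric] mult_ac)
    also have "\<dots> = (\<Sum>j<8. cnj (k i 8) * k l 8 * (k i j * cnj (k l j)))"
    proof (rule sum.cong[OF refl])
      fix j
      have "d i j * cnj (d l j) = cnj (k i 8) * k l 8 * (k i j * cnj (k l j)) *
        (k 8 j * cnj (k 8 j)) * (k 8 8 * cnj (k 8 8))"
        by (simp add: d_def mult_ac)
      then show "d i j * cnj (d l j) = cnj (k i 8) * k l 8 * (k i j * cnj (k l j))"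
        by (simp add: unit')
    qed
    also have "\<dots> = - ((k i 8 * cnj (k i 8)) * (k l 8 * cnj (k l 8)))"
      by (simp add: sum_distrib_left[symmetric] *)
    also have "\<dots> = -1"
      by (simp add: unit')
    finally show "(\<Sum>j<8. core core_values i j * cnj (core core_values l j) * (u i j * cnj (u l j))) = -1" .
  next
    fix j
    have "u 8 j = (k 8 j * cnj (k 8 j)) * (k 8 8 * cnj (k 8 8))"
      by (simp add: u_def d_def core_def mult_ac)
    then show "u 8 j = 1"
      by (simp add: unit')
  next
    fix i j :: nat
    show "cmod (u i j) = 1"
      by (simp add: u_def d_def norm_mult unit norm_core)
    assume ij: "i < 8" "j < 8"
    have "u i j - 1 = (d i j - core core_values i j) * cnj (core core_values i j)"
      by (simp add: u_def left_diff_distrib core1)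
    \<comment> \<open>The inserted ones match the four unit factors of \<open>d\<close>. Each is
      within 1/4000 of its target, which meets the threshold 1/1000 of
      \<open>core_rigid\<close>.\<close>
    then have "cmod (u i j - 1) = cmod (d i j - core core_values i j * 1 * (1 * 1))"
      by (simp add: norm_mult norm_core)
    also have "\<dots> \<le> cmod (k i j - core core_values i j) + cmod (cnj (k i 8) - 1) +
        (cmod (cnj (k 8 j) - 1) + cmod (k 8 8 - 1))"
      unfolding d_def
      by (intro order_trans[OF norm_mult_diff_le] add_mono order_refl)
        (simp_all add: norm_mult unit norm_core)
    also have "\<dots> = cmod (k i j - core core_values i j) + cmod (k i 8 - 1) +
        (cmod (k 8 j - 1) + cmod (k 8 8 - 1))"
      using complex_mod_cnj[of "k i 8 - 1"] complex_mod_cnj[of "k 8 j - 1"] by simp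
    also have "\<dots> \<le> 1 / 4000 + 1 / 4000 + (1 / 4000 + 1 / 4000)"
      using ij k_near[of i j] k_near[of i 8] k_near[of 8 j] k_near[of 8 8]
      by (intro add_mono) (simp_all add: core_def)
    finally show "cmod (u i j - 1) \<le> 1 / 1000"
      by simp
  qed auto
  have entry: "k i j = k i 8 * (if j < 8 then core core_values i j else 1) * (k 8 j * cnj (k 8 8))"
    if "i < 9" "j < 9" for i j
  proof -
    have "d i j = (if j < 8 then core core_values i j else 1)"
    proof (cases "i < 8 \<and> j < 8")
      case True
      then show ?thesis
        using u_core[of i j] u1 by simp
    next
      case False
      then have "i = 8 \<or> j = 8"
        using that by linarith
      then have "d i j = 1"
      proof
        assume "i = 8"
        then show ?thesis
          using unit'[of 8 j] unit'[of 8 8] by (simp add: d_def mult_ac)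
      qed (simp add: d_def unit')
      then show ?thesis
        using False by (auto simp: core_def)
    qed
    moreover have "k i 8 * d i j * (k 8 j * cnj (k 8 8)) =
      k i j * (k i 8 * cnj (k i 8)) * (k 8 j * cnj (k 8 j)) * (k 8 8 * cnj (k 8 8))"
      by (simp add: d_def mult_ac)
    ultimately show ?thesis
      by (simp add: unit')
  qed
  show ?thesis
  proof (rule hadamard_equivI)
    have unit_K: "cmod (K $ i $ j) = 1" for i j
      using K by (simp add: complex_hadamard_def)
    show "cmod (K $ i $ col_index 8) = 1" "cmod (K $ row_index 8 $ i * cnj (K $ row_index 8 $ col_index 8)) = 1" for i
      by (simp_all add: unit_K norm_mult)
    show "K $ i $ j = K $ i $ col_index 8 * Y9C $ i $ j * (K $ row_index 8 $ j * cnj (K $ row_index 8 $ col_index 8))"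
      for i j
    proof -
      obtain i' where i: "i' < 9" "i = row_index i'"
        by (rule row_index_cases)
      obtain j' where j: "j' < 9" "j = col_index j'"
        by (rule col_index_cases)
      show ?thesis
        using entry[OF i(1) j(1)] unfolding i(2) j(2) k_def Y9C_entry[OF i(1) j(1)] .
    qed
  qed
qed

theorem proposition1:
  shows "complex_hadamard Y9C \<and> isolated_hadamard Y9C"
proof -
  have "hadamard_equiv K Y9C" if "K \<in> ball Y9C (1 / 4000)" "complex_hadamard K" for K
  proof (rule rigid_Y9C[OF that(2)])
    fix i j :: 9
    \<comment> \<open>The norm of nested vectors is the Frobenius norm, which dominates every
      entry.\<close>
    have "cmod (K $ i $ j - Y9C $ i $ j) \<le> norm (K - Y9C)"
      using Finite_Cartesian_Product.norm_nth_le[of "K - Y9C" i]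
        Finite_Cartesian_Product.norm_nth_le[of "(K - Y9C) $ i" j] by simp
    then show "cmod (K $ i $ j - Y9C $ i $ j) \<le> 1 / 4000"
      using that(1) by (simp add: dist_norm norm_minus_commute)
  qed
  then show ?thesis
    unfolding isolated_hadamard_def
    using complex_hadamard_Y9C by (auto intro!: exI[of _ "ball Y9C (1 / 4000)"])
qed

end
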